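(* There is an absolute constant $C>0$ such that the following holds. Let $G$ be an abelian group, let $A\subseteq G$ be a finite set with $|A|\ge 2$, and let $K\ge 1$ be a real number with $|A+A|\le K|A|$. Then $$\dim(A)\le C\,K\log|A|$$ and $$\dim(A)\le C\big(\log|A|+K(\log K)^{8}\log\log|A|\big).$$
   Context: $A+A=\{a+a' : a,a'\in A\}$. All logarithms are to base $2$. A finite subset $\Lambda$ of an abelian group is dissociated if $\sum_{\lambda\in\Lambda}\varepsilon_\lambda\lambda=0$ with all $\varepsilon_\lambda\in\{-1,0,1\}$ implies $\varepsilon_\lambda=0$ for all $\lambda$ (the empty set is dissociated). For a finite set $A$, $\dim(A)$ is the maximal cardinality of a dissociated subset of $A$. *)

theory Defs
  imports Complex_Main "HOL-Algebra.Coset" "HOL-Algebra.FiniteProduct"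
begin

text \<open>
  Abelian groups are the library's commutative groups \<open>comm_group\<close>, written multiplicatively:
  the sumset \<open>A + A\<close> is \<open>A <#>\<^bsub>G\<^esub> A\<close>, and the sum of the terms \<open>\<epsilon> x \<cdot> x\<close> over \<open>x \<in> S\<close> is the
  \<open>finprod\<close> of the powers \<open>x [^]\<^bsub>G\<^esub> \<epsilon> x\<close>.
\<close>

definition dissociated :: "('a, 'b) monoid_scheme \<Rightarrow> 'a set \<Rightarrow> bool" where
  "dissociated G S \<longleftrightarrow>
     finite S \<and> S \<subseteq> carrier G \<and>
     (\<forall>\<epsilon> :: 'a \<Rightarrow> int.
        (\<forall>x\<in>S. \<epsilon> x \<in> {-1, 0, 1}) \<longrightarrow>
        finprod G (\<lambda>x. x [^]\<^bsub>G\<^esub> \<epsilon> x) S = \<one>\<^bsub>G\<^esub> \<longrightarrow>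
        (\<forall>x\<in>S. \<epsilon> x = 0))"

definition additive_dim :: "('a, 'b) monoid_scheme \<Rightarrow> 'a set \<Rightarrow> nat" where
  "additive_dim G A = Max {card S | S. S \<subseteq> A \<and> dissociated G S}"

definition dim_bounds :: "real \<Rightarrow> ('a, 'b) monoid_scheme \<Rightarrow> bool" where
  "dim_bounds C G \<longleftrightarrow>
     (\<forall>A (K :: real).
        A \<subseteq> carrier G \<longrightarrow> finite A \<longrightarrow> 2 \<le> card A \<longrightarrow> 1 \<le> K \<longrightarrow>
        real (card (A <#>\<^bsub>G\<^esub> A)) \<le> K * real (card A) \<longrightarrow>
          real (additive_dim G A) \<le> C * (K * log 2 (real (card A))) \<and>
          real (additive_dim G A) \<le>
            C * (log 2 (real (card A)) + K * (log 2 K) ^ 8 * log 2 (log 2 (real (card A)))))"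

text \<open>
  The constant must not depend on the group.  In a polymorphic statement
  \<open>\<exists>C > 0. \<forall>G :: ('a, 'b) monoid_scheme. \<dots>\<close> it could still depend on the type \<open>'a\<close> of the
  group elements, and HOL cannot quantify over types inside a formula.  The constant is
  therefore named outside the statement, as a single real number: some positive constant that
  works for all abelian groups whose carrier is a set of natural numbers, if there is one.
  This is no loss, as the subgroup generated by a finite set is countable, so that a constant
  which works for these groups works for all.  Nothing is claimed by the definition itself:
  that such a constant exists, and is valid for groups over every type, is left to be proved.
\<close>

definition dim_const :: real where
  "dim_const = (SOME C. 0 < C \<and> (\<forall>G :: nat monoid. comm_group G \<longrightarrow> dim_bounds C G))"

end

theory Submission
  imports Defs "HOL-Library.Countable_Set"
begin

text \<open>
  The subset sums of a dissociated set L in A are distinct, so |L| is bounded by the growth of the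
  iterated sumsets nA. The bound \<open>|nA| \<le> K^n |A|\<close> of Pluennecke gives the first estimate.
  For the second one, let \<open>W = 2A - 2A\<close>. Croot--Sisask almost periodicity gives T in A with
  \<open>5(T - T) \<subseteq> W\<close> and \<open>|T| \<ge> exp(-O((log K)^2)) |A|\<close>, and Chang's covering argument gives
  \<open>A \<subseteq> T - T + Q\<close>, where Q is a box spanned by \<open>O(K (log K)^2)\<close> elements. Hence
  \<open>W + A = 3A - 2A \<subseteq> 5(T - T) + 5Q \<subseteq> W + 5Q\<close>, so \<open>nA \<subseteq> W + 5nQ\<close> for all n, and |nA|
  grows only polynomially, of degree \<open>O(K (log K)^2)\<close>. For \<open>K < 3/2\<close>, where powers of \<open>log K\<close> are of
  no use, \<open>A - A\<close> is a subgroup of order at most 2|A|.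
\<close>

subsection \<open>Growth of product sets\<close>

text \<open>The number five comes from the four copies of \<open>A\<close> in \<open>W\<close> and
  one more, each replaced by \<open>T - T + Q\<close>; this is why fivefold sums of differences of
  \<open>T\<close> have to stay inside \<open>W\<close>. Since \<open>W\<close> is then paid for
  only once, by \<open>|W| \<le> K^4 |A|\<close>, the term \<open>log |A|\<close> carries no factor
  \<open>K\<close>. The loss \<open>|A| / |T|\<close> enters the covering only through its
  logarithm, as the number of rounds. The box costs its number of generators times the logarithm of
  its side, and this side involves \<open>|L|\<close> itself; the first estimate is inserted there,
  which is where \<open>log log |A|\<close> comes from. For \<open>K \<ge> 2\<close> the result is
  of order \<open>log |A| + K (log K)^3 log log |A|\<close>. The passage to the eighth power needs
  \<open>log K\<close> bounded below, so doubling near \<open>1\<close> has to be treated by a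
  separate argument in which no box occurs.\<close>

context comm_group
begin

primrec spow :: "'a set \<Rightarrow> nat \<Rightarrow> 'a set" where
  "spow A 0 = {\<one>}"
| "spow A (Suc n) = spow A n <#> A"

abbreviation diffset :: "'a set \<Rightarrow> 'a set" where
  "diffset A \<equiv> A <#> m_inv G ` A"

lemma set_mult_image: "A <#> B = (\<lambda>(a, b). a \<otimes> b) ` (A \<times> B)"
  by (auto simp: set_mult_def)

lemma finite_set_mult [simp]: "finite A \<Longrightarrow> finite B \<Longrightarrow> finite (A <#> B)"
  by (simp add: set_mult_image)

lemma card_set_mult_le: "finite A \<Longrightarrow> finite B \<Longrightarrow> card (A <#> B) \<le> card A * card B"
  by (metis card_image_le card_cartesian_product finite_cartesian_product set_mult_image)

lemma set_multI: "a \<in> A \<Longrightarrow> b \<in> B \<Longrightarrow> a \<otimes> b \<in> A <#> B"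
  by (auto simp: set_mult_def)

lemma set_multE:
  assumes "x \<in> A <#> B" obtains a b where "a \<in> A" "b \<in> B" "x = a \<otimes> b"
  using assms by (auto simp: set_mult_def)

lemma inv_image_closed [simp]: "A \<subseteq> carrier G \<Longrightarrow> m_inv G ` A \<subseteq> carrier G"
  by auto

declare set_mult_closed [simp]

lemma sumset_commute:
  "A \<subseteq> carrier G \<Longrightarrow> B \<subseteq> carrier G \<Longrightarrow> A <#> B = B <#> A"
  unfolding set_mult_def using m_comm by blast

lemma set_mult_left_commute:
  "A \<subseteq> carrier G \<Longrightarrow> B \<subseteq> carrier G \<Longrightarrow> C \<subseteq> carrier G \<Longrightarrow> A <#> (B <#> C) = B <#> (A <#> C)"
  using set_mult_assoc[of A B C] set_mult_assoc[of B A C] sumset_commute[of A B] by simp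

lemmas set_mult_ac = set_mult_assoc sumset_commute set_mult_left_commute

lemma spow_closed [simp]: "A \<subseteq> carrier G \<Longrightarrow> spow A n \<subseteq> carrier G"
  by (induction n) auto

lemma finite_spow [simp]: "finite A \<Longrightarrow> finite (spow A n)"
  by (induction n) auto

lemma one_set_mult [simp]: "A \<subseteq> carrier G \<Longrightarrow> {\<one>} <#> A = A"
  by (force simp: set_mult_def)

lemma set_mult_one [simp]: "A \<subseteq> carrier G \<Longrightarrow> A <#> {\<one>} = A"
  by (force simp: set_mult_def)

lemma spow_1: "A \<subseteq> carrier G \<Longrightarrow> spow A (Suc 0) = A"
  by simp

lemma spow_add:
  "A \<subseteq> carrier G \<Longrightarrow> spow A (m + n) = spow A m <#> spow A n"
  by (induction n) (simp_all add: set_mult_assoc)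

lemma spow_mult_distrib:
  "A \<subseteq> carrier G \<Longrightarrow> B \<subseteq> carrier G \<Longrightarrow> spow (A <#> B) n = spow A n <#> spow B n"
  by (induction n) (simp_all add: set_mult_ac)

lemma spow_spow: "A \<subseteq> carrier G \<Longrightarrow> spow (spow A m) n = spow A (m * n)"
proof (induction n)
  case (Suc n)
  then show ?case
    using spow_add[of A "m * n" m] by (simp add: add.commute)
qed simp

lemma spow_mono: "A \<subseteq> B \<Longrightarrow> spow A n \<subseteq> spow B n"
  by (induction n) (simp_all add: mono_set_mult)

lemma one_in_spow: "\<one> \<in> A \<Longrightarrow> \<one> \<in> spow A n"
proof (induction n)
  case (Suc n)
  then show ?case using set_multI[of \<one> "spow A n" \<one> A] by simp
qed simp

lemma subset_set_mult_right: "\<one> \<in> B \<Longrightarrow> A \<subseteq> carrier G \<Longrightarrow> A \<subseteq> A <#> B"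
  by (force simp: set_mult_def)

lemma spow_mono_exp:
  assumes "\<one> \<in> A" "A \<subseteq> carrier G" "m \<le> n" shows "spow A m \<subseteq> spow A n"
proof -
  have "spow A m \<subseteq> spow A m <#> spow A (n - m)"
    using assms by (intro subset_set_mult_right one_in_spow) auto
  then show ?thesis using spow_add[of A m "n - m"] assms by simp
qed

lemma inv_set_mult:
  "A \<subseteq> carrier G \<Longrightarrow> B \<subseteq> carrier G \<Longrightarrow> m_inv G ` (A <#> B) = m_inv G ` A <#> m_inv G ` B"
  by (force simp: set_mult_def inv_mult image_UN)

lemma inv_spow: "A \<subseteq> carrier G \<Longrightarrow> m_inv G ` spow A n = spow (m_inv G ` A) n"
  by (induction n) (simp_all add: inv_set_mult)

lemma inv_inv_image [simp]: "A \<subseteq> carrier G \<Longrightarrow> m_inv G ` m_inv G ` A = A"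
  by (force simp: image_iff)

lemma inv_diffset: "A \<subseteq> carrier G \<Longrightarrow> m_inv G ` diffset A = diffset A"
  by (simp add: inv_set_mult sumset_commute)

lemma inj_on_mult_left: "c \<in> carrier G \<Longrightarrow> A \<subseteq> carrier G \<Longrightarrow> inj_on (\<lambda>x. c \<otimes> x) A"
  by (rule inj_on_subset[OF inj_on_cmult])

lemma card_translate [simp]:
  "c \<in> carrier G \<Longrightarrow> A \<subseteq> carrier G \<Longrightarrow> card ((\<lambda>x. c \<otimes> x) ` A) = card A"
  by (simp add: card_image inj_on_mult_left)

lemma card_set_mult_ge:
  assumes "finite A" "finite B" "A \<subseteq> carrier G" "B \<subseteq> carrier G" "B \<noteq> {}"
  shows "card A \<le> card (A <#> B)"
proof -
  obtain b where b: "b \<in> B" using assms by auto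
  have "(\<lambda>x. b \<otimes> x) ` A \<subseteq> A <#> B"
    using assms b by (auto simp: set_mult_def intro!: bexI m_comm)
  then have "card ((\<lambda>x. b \<otimes> x) ` A) \<le> card (A <#> B)"
    using assms by (intro card_mono) auto
  then show ?thesis using b assms by auto
qed

section \<open>Petridis' lemma and the inequalities of Pluennecke and Ruzsa\<close>

text \<open>Take \<open>X\<close> minimising \<open>|XA| / |X|\<close> among the nonempty subsets of
  \<open>A\<close>, with minimum \<open>L\<close>, and add the elements of \<open>C\<close> one at a
  time. Minimality gives \<open>|YA| \<ge> L |Y|\<close> for all \<open>Y \<subseteq> X\<close>, so
  \<open>CXA\<close> gains at most \<open>L\<close> times what \<open>CX\<close> gains.\<close>

lemma petridis:
  assumes A: "finite A" "A \<subseteq> carrier G" "A \<noteq> {}"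
    and K: "real (card (A <#> A)) \<le> K * real (card A)"
  obtains X where "X \<subseteq> A" "X \<noteq> {}"
    "\<And>C. finite C \<Longrightarrow> C \<subseteq> carrier G \<Longrightarrow> real (card (C <#> (X <#> A))) \<le> K * real (card (C <#> X))"
proof -
  define r where "r Z = real (card (Z <#> A)) / real (card Z)" for Z
  have fin: "finite (Pow A - {{}})" and ne: "Pow A - {{}} \<noteq> {}" using A by auto
  obtain X where X: "X \<in> Pow A - {{}}" and min: "\<And>Z. Z \<in> Pow A - {{}} \<Longrightarrow> r X \<le> r Z"
    using ex_min_if_finite[of "r ` (Pow A - {{}})"] fin ne by (auto simp: not_less)
  define L where "L = r X"
  have fX: "finite X" "X \<subseteq> carrier G" "card X > 0"
    using X A by (auto simp: card_gt_0_iff intro: finite_subset)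
  have LZ: "L * real (card Z) \<le> real (card (Z <#> A))" if "Z \<subseteq> X" for Z
  proof (cases "Z = {}")
    case False
    then have "card Z > 0" using that fX by (auto simp: card_gt_0_iff intro: finite_subset)
    then show ?thesis using min[of Z] False that X unfolding L_def r_def[of Z]
      by (auto simp: field_simps)
  qed simp
  have LX: "real (card (X <#> A)) = L * real (card X)"
    using fX by (auto simp: L_def r_def)
  have LK: "L \<le> K"
  proof -
    have "L \<le> r A" unfolding L_def using min A by auto
    also have "r A \<le> K" using K A unfolding r_def
      by (metis card_gt_0_iff of_nat_0_less_iff pos_divide_le_eq)
    finally show ?thesis .
  qed
  have main: "real (card (C <#> (X <#> A))) \<le> L * real (card (C <#> X))"
    if "finite C" "C \<subseteq> carrier G" for C
    using that
  proof (induction C rule: finite_induct)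
    case empty
    then show ?case by (simp add: set_mult_def)
  next
    case (insert c C)
    then have c: "c \<in> carrier G" "C \<subseteq> carrier G" by auto
    \<comment> \<open>\<open>Y\<close> collects the \<open>x\<close> for which \<open>cx\<close> is
      already in \<open>CX\<close>; then \<open>cYA\<close> lies in \<open>CXA\<close>, and only
      \<open>cXA - cYA\<close> can be new.\<close>
    define Y where "Y = {x \<in> X. c \<otimes> x \<in> C <#> X}"
    have YX: "Y \<subseteq> X" and fY: "finite Y" "Y \<subseteq> carrier G" using fX by (auto simp: Y_def)
    let ?t = "\<lambda>S. (\<lambda>x. c \<otimes> x) ` S"
    have sub: "insert c C <#> (X <#> A) \<subseteq> (C <#> (X <#> A)) \<union> (?t (X <#> A) - ?t (Y <#> A))"
    proof
      fix z assume z: "z \<in> insert c C <#> (X <#> A)"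
      have YA: "?t (Y <#> A) \<subseteq> C <#> (X <#> A)"
      proof
        fix w assume "w \<in> ?t (Y <#> A)"
        then obtain y a where ya: "y \<in> Y" "a \<in> A" "w = c \<otimes> (y \<otimes> a)"
          by (auto elim!: set_multE)
        then have "w = (c \<otimes> y) \<otimes> a" using c fY A m_assoc[of c y a] by (simp add: subset_iff)
        then have "w \<in> (C <#> X) <#> A" using ya by (auto simp: Y_def intro: set_multI)
        then show "w \<in> C <#> (X <#> A)" using set_mult_assoc[of C X A] c fX A by simp
      qed
      from z have "z \<in> C <#> (X <#> A) \<or> z \<in> ?t (X <#> A)"
        by (auto simp: set_mult_def)
      then show "z \<in> (C <#> (X <#> A)) \<union> (?t (X <#> A) - ?t (Y <#> A))"
        using YA by blast
    qed
    have YAX: "Y <#> A \<subseteq> X <#> A" using YX by (intro mono_set_mult) auto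
    have "card (insert c C <#> (X <#> A)) \<le> card ((C <#> (X <#> A)) \<union> (?t (X <#> A) - ?t (Y <#> A)))"
      using sub fX A insert.hyps by (intro card_mono) auto
    also have "\<dots> \<le> card (C <#> (X <#> A)) + card (?t (X <#> A) - ?t (Y <#> A))"
      by (rule card_Un_le)
    also have "card (?t (X <#> A) - ?t (Y <#> A)) = card (X <#> A) - card (Y <#> A)"
      using fX fY A c YAX by (subst card_Diff_subset) auto
    finally have up: "real (card (insert c C <#> (X <#> A)))
        \<le> real (card (C <#> (X <#> A))) + (real (card (X <#> A)) - real (card (Y <#> A)))"
      using card_mono[OF _ YAX] fX A by (simp add: of_nat_diff)
    have "(C <#> X) \<union> ?t (X - Y) \<subseteq> insert c C <#> X"
      by (auto simp: set_mult_def)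
    then have "card ((C <#> X) \<union> ?t (X - Y)) \<le> card (insert c C <#> X)"
      using fX insert.hyps by (intro card_mono) auto
    moreover have "card ((C <#> X) \<union> ?t (X - Y)) = card (C <#> X) + card (?t (X - Y))"
      using fX insert.hyps by (intro card_Un_disjoint) (auto simp: Y_def)
    moreover have "card (?t (X - Y)) = card (X - Y)" using c fX by (intro card_translate) auto
    moreover have "card (X - Y) = card X - card Y" using YX fY by (simp add: card_Diff_subset)
    ultimately have low: "real (card (C <#> X)) + (real (card X) - real (card Y)) \<le> real (card (insert c C <#> X))"
      using card_mono[OF fX(1) YX] by linarith
    have L0: "L \<ge> 0" by (simp add: L_def r_def)
    have "real (card (insert c C <#> (X <#> A))) \<le> L * real (card (C <#> X)) + (L * real (card X) - L * real (card Y))"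
      using up insert.IH c LX LZ[OF YX] by linarith
    also have "\<dots> = L * (real (card (C <#> X)) + (real (card X) - real (card Y)))"
      by (simp add: algebra_simps)
    also have "\<dots> \<le> L * real (card (insert c C <#> X))"
      using low L0 by (rule mult_left_mono)
    finally show ?case .
  qed
  show thesis
  proof
    show "X \<subseteq> A" "X \<noteq> {}" using X by auto
    fix C assume "finite C" "C \<subseteq> carrier G"
    then show "real (card (C <#> (X <#> A))) \<le> K * real (card (C <#> X))"
      using main[of C] LK by (meson mult_right_mono of_nat_0_le_iff order_trans)
  qed
qed

text \<open>Taking \<open>C = spow A n\<close> in Petridis' inequality gains one factor
  \<open>K\<close> per step. The same \<open>X\<close> serves every \<open>n\<close>, so that two
  different exponents can be combined in the quotient estimate.\<close>

lemma petridis_spow: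
  assumes A: "finite A" "A \<subseteq> carrier G" "A \<noteq> {}"
    and K: "real (card (A <#> A)) \<le> K * real (card A)"
  obtains X where "X \<subseteq> A" "X \<noteq> {}"
    "\<And>n. real (card (X <#> spow A n)) \<le> K ^ n * real (card X)"
proof -
  obtain X where X: "X \<subseteq> A" "X \<noteq> {}" and
    C: "\<And>C. finite C \<Longrightarrow> C \<subseteq> carrier G \<Longrightarrow> real (card (C <#> (X <#> A))) \<le> K * real (card (C <#> X))"
    using petridis[OF assms] by blast
  have Xc: "X \<subseteq> carrier G" using X A by auto
  have "0 < card A" using A by (simp add: card_gt_0_iff)
  moreover have "0 \<le> K * real (card A)" using K by (meson of_nat_0_le_iff order_trans)
  ultimately have K0: "0 \<le> K" by (simp add: zero_le_mult_iff)
  have "real (card (X <#> spow A n)) \<le> K ^ n * real (card X)" for n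
  proof (induction n)
    case 0 then show ?case using Xc by simp
  next
    case (Suc n)
    have "X <#> spow A (Suc n) = spow A n <#> (X <#> A)"
      using Xc A by (simp add: set_mult_ac)
    then have "real (card (X <#> spow A (Suc n))) \<le> K * real (card (spow A n <#> X))"
      using C[of "spow A n"] A by simp
    also have "spow A n <#> X = X <#> spow A n" using Xc A by (simp add: sumset_commute)
    also have "K * real (card (X <#> spow A n)) \<le> K * (K ^ n * real (card X))"
      using Suc K0 by (intro mult_left_mono)
    finally show ?case by (simp add: mult.assoc)
  qed
  then show thesis using that X by blast
qed

lemma plunnecke:
  assumes A: "finite A" "A \<subseteq> carrier G" "A \<noteq> {}"
    and K: "real (card (A <#> A)) \<le> K * real (card A)"
  shows "real (card (spow A n)) \<le> K ^ n * real (card A)"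
proof -
  obtain X where X: "X \<subseteq> A" "X \<noteq> {}" 
    "\<And>n. real (card (X <#> spow A n)) \<le> K ^ n * real (card X)"
    using petridis_spow[OF assms] by blast
  have fX: "finite X" "X \<subseteq> carrier G" using X A by (auto intro: finite_subset)
  have "0 < card A" using A by (simp add: card_gt_0_iff)
  moreover have "0 \<le> K * real (card A)" using K by (meson of_nat_0_le_iff order_trans)
  ultimately have K0: "0 \<le> K" by (simp add: zero_le_mult_iff)
  have "card (spow A n) \<le> card (spow A n <#> X)"
    using X A fX by (intro card_set_mult_ge) auto
  also have "spow A n <#> X = X <#> spow A n" using fX A by (simp add: sumset_commute)
  finally have "real (card (spow A n)) \<le> K ^ n * real (card X)" using X(3)[of n] by linarith
  also have "\<dots> \<le> K ^ n * real (card A)"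
    using K0 X A by (intro mult_left_mono) (auto intro: card_mono)
  finally show ?thesis .
qed

text \<open>Fix one representation \<open>d = v d \<otimes> inv (z d)\<close> of each quotient. The
  map from \<open>(u, d)\<close> to \<open>(u \<otimes> v d, u \<otimes> z d)\<close> is injective:
  the quotient of the coordinates recovers \<open>d\<close>, and cancellation then recovers
  \<open>u\<close>.\<close>

lemma ruzsa_triangle:
  assumes "finite U" "finite V" "finite Z" "U \<subseteq> carrier G" "V \<subseteq> carrier G" "Z \<subseteq> carrier G"
  shows "card U * card (V <#> m_inv G ` Z) \<le> card (U <#> V) * card (U <#> Z)"
proof -
  let ?D = "V <#> m_inv G ` Z"
  have "\<forall>d\<in>?D. \<exists>v z. v \<in> V \<and> z \<in> Z \<and> d = v \<otimes> inv z"
    by (auto simp: set_mult_def)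
  then obtain v z where vz: "\<And>d. d \<in> ?D \<Longrightarrow> v d \<in> V \<and> z d \<in> Z \<and> d = v d \<otimes> inv (z d)"
    by metis
  let ?f = "\<lambda>(u, d). (u \<otimes> v d, u \<otimes> z d)"
  have "inj_on ?f (U \<times> ?D)"
  proof (rule inj_onI, clarify)
    fix u d u' d' assume h: "u \<in> U" "d \<in> ?D" "u' \<in> U" "d' \<in> ?D"
      "u \<otimes> v d = u' \<otimes> v d'" "u \<otimes> z d = u' \<otimes> z d'"
    have c: "u \<in> carrier G" "u' \<in> carrier G" "v d \<in> carrier G" "z d \<in> carrier G"
      "v d' \<in> carrier G" "z d' \<in> carrier G"
      using h vz assms by blast+
    have *: "d = (u \<otimes> v d) \<otimes> inv (u \<otimes> z d)" if "u \<in> carrier G" "v d \<in> carrier G" "z d \<in> carrier G" "d \<in> ?D" for u d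
    proof -
      have "(u \<otimes> v d) \<otimes> inv (u \<otimes> z d) = (u \<otimes> inv u) \<otimes> (v d \<otimes> inv (z d))"
        using that by (simp only: inv_mult m_closed inv_closed m_ac)
      moreover have "u \<otimes> inv u = \<one>" "\<one> \<otimes> (v d \<otimes> inv (z d)) = v d \<otimes> inv (z d)"
        using that by simp_all
      ultimately show ?thesis using vz[OF that(4)] by simp
    qed
    have "d = d'" using *[of u d] *[of u' d'] c h by simp
    then show "u = u' \<and> d = d'" using h c by auto
  qed
  then have "card (U \<times> ?D) \<le> card ((U <#> V) \<times> (U <#> Z))"
    using vz assms by (intro card_inj_on_le[of ?f]) (auto intro: set_multI)
  then show ?thesis by (simp add: card_cartesian_product)
qed

text \<open>Ruzsa's triangle inequality with the Petridis set \<open>X\<close> as \<open>U\<close>: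
  each factor on the right is at most a power of \<open>K\<close> times \<open>|X|\<close>, so one
  \<open>|X|\<close> cancels and the other is at most \<open>|A|\<close>.\<close>

lemma card_sum_diff_le:
  assumes A: "finite A" "A \<subseteq> carrier G" "A \<noteq> {}"
    and K: "real (card (A <#> A)) \<le> K * real (card A)"
  shows "real (card (spow A m <#> m_inv G ` spow A n)) \<le> K ^ (m + n) * real (card A)"
proof -
  obtain X where X: "X \<subseteq> A" "X \<noteq> {}" 
    "\<And>n. real (card (X <#> spow A n)) \<le> K ^ n * real (card X)"
    using petridis_spow[OF assms] by blast
  have fX: "finite X" "X \<subseteq> carrier G" "card X > 0" using X A by (auto simp: card_gt_0_iff intro: finite_subset)
  have "0 < card A" using A by (simp add: card_gt_0_iff)
  moreover have "0 \<le> K * real (card A)" using K by (meson of_nat_0_le_iff order_trans)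
  ultimately have K0: "0 \<le> K" by (simp add: zero_le_mult_iff)
  let ?D = "spow A m <#> m_inv G ` spow A n"
  have "card X * card ?D \<le> card (X <#> spow A m) * card (X <#> spow A n)"
    using fX A by (intro ruzsa_triangle) auto
  then have "real (card X) * real (card ?D) \<le> real (card (X <#> spow A m)) * real (card (X <#> spow A n))"
    by (metis of_nat_le_iff of_nat_mult)
  also have "\<dots> \<le> (K ^ m * real (card X)) * (K ^ n * real (card X))"
    using X(3) K0 by (intro mult_mono) auto
  also have "\<dots> = real (card X) * (K ^ (m + n) * real (card X))" by (simp add: power_add)
  finally have "real (card ?D) \<le> K ^ (m + n) * real (card X)"
    using fX by (subst (asm) mult_le_cancel_left_pos) auto
  also have "\<dots> \<le> K ^ (m + n) * real (card A)"
    using K0 X A by (intro mult_left_mono) (auto intro: card_mono)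
  finally show ?thesis .
qed

subsection \<open>Dissociated sets and coverings\<close>

text \<open>If two subsets have equal products, the difference of their indicator functions is a
  relation with coefficients in \<open>{-1, 0, 1}\<close>, hence zero.\<close>

lemma inj_on_subset_products:
  assumes L: "dissociated G L"
  shows "inj_on (finprod G (\<lambda>x. x)) (Pow L)"
proof (rule inj_onI)
  fix I J assume IJ: "I \<in> Pow L" "J \<in> Pow L" "finprod G (\<lambda>x. x) I = finprod G (\<lambda>x. x) J"
  have fL: "finite L" "L \<subseteq> carrier G" using L by (auto simp: dissociated_def)
  define e where "e I x = (if x \<in> I then 1 else 0 :: int)" for I :: "'a set" and x
  define \<epsilon> where "\<epsilon> x = e I x - e J x" for x
  have prod_e: "finprod G (\<lambda>x. x [^] e I x) L = finprod G (\<lambda>x. x) I" if "I \<subseteq> L" for I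
    using that fL by (intro finprod_mono_neutral_cong_right) (auto simp: e_def)
  have "finprod G (\<lambda>x. x [^] \<epsilon> x) L \<otimes> finprod G (\<lambda>x. x [^] e J x) L
      = finprod G (\<lambda>x. x [^] \<epsilon> x \<otimes> x [^] e J x) L"
    using fL by (intro finprod_multf[symmetric]) auto
  also have "\<dots> = finprod G (\<lambda>x. x [^] e I x) L"
    using fL by (intro finprod_cong') (auto simp: \<epsilon>_def int_pow_mult[symmetric])
  finally have "finprod G (\<lambda>x. x [^] \<epsilon> x) L \<otimes> finprod G (\<lambda>x. x) J = finprod G (\<lambda>x. x) J"
    using IJ prod_e by auto
  moreover have "finprod G (\<lambda>x. x) J \<in> carrier G" using IJ fL by (intro finprod_closed) auto
  moreover have "finprod G (\<lambda>x. x [^] \<epsilon> x) L \<in> carrier G" using fL by (intro finprod_closed) auto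
  ultimately have "finprod G (\<lambda>x. x [^] \<epsilon> x) L = \<one>" by (simp add: r_cancel_one)
  moreover have "\<forall>x\<in>L. \<epsilon> x \<in> {-1, 0, 1}" by (auto simp: \<epsilon>_def e_def)
  ultimately have "\<forall>x\<in>L. \<epsilon> x = 0" using L by (auto simp: dissociated_def)
  then have "x \<in> I \<longleftrightarrow> x \<in> J" if "x \<in> L" for x
    using that by (auto simp: \<epsilon>_def e_def split: if_splits)
  then show "I = J" using IJ by blast
qed

lemma finprod_in_spow:
  assumes "finite I" "I \<subseteq> A" "A \<subseteq> carrier G"
  shows "finprod G (\<lambda>x. x) I \<in> spow A (card I)"
  using assms
proof (induction I rule: finite_induct)
  case (insert x I)
  have "finprod G (\<lambda>x. x) (insert x I) = x \<otimes> finprod G (\<lambda>x. x) I"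
    using insert by (intro finprod_insert) auto
  also have "\<dots> = finprod G (\<lambda>x. x) I \<otimes> x"
    using insert by (intro m_comm finprod_closed) auto
  finally show ?case using insert by (auto intro: set_multI)
qed simp

text \<open>Subsets of one fixed size are counted, so that their products lie in the single set
  \<open>spow A k\<close> even when \<open>\<one>\<close> is not in \<open>A\<close>.\<close>

lemma binomial_le_card_spow:
  assumes "dissociated G L" "L \<subseteq> A" "finite A" "A \<subseteq> carrier G"
  shows "card L choose k \<le> card (spow A k)"
proof -
  have fL: "finite L" using assms by (auto simp: dissociated_def)
  have "card {I. I \<subseteq> L \<and> card I = k} \<le> card (spow A k)"
  proof (rule card_inj_on_le)
    show "inj_on (finprod G (\<lambda>x. x)) {I. I \<subseteq> L \<and> card I = k}"
      using inj_on_subset_products[OF assms(1)] by (rule inj_on_subset) auto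
    show "finprod G (\<lambda>x. x) ` {I. I \<subseteq> L \<and> card I = k} \<subseteq> spow A k"
    proof clarify
      fix I assume "I \<subseteq> L" "k = card I"
      then show "finprod G (\<lambda>x. x) I \<in> spow A (card I)"
        using assms fL by (intro finprod_in_spow) (auto intro: finite_subset)
    qed
  qed (use assms in auto)
  then show ?thesis using n_subsets[OF fL] by simp
qed

text \<open>With \<open>k\<close> just above \<open>log |A|\<close> one has
  \<open>|A| \<le> 2^k\<close>, so the upper bound \<open>K^k |A|\<close> is at most the
  \<open>k\<close>-th power \<open>(2K)^k\<close>, and taking roots gives
  \<open>|L| / k \<le> 2K\<close>.\<close>

lemma dissociated_bound:
  assumes L: "dissociated G L" "L \<subseteq> A" and A: "finite A" "A \<subseteq> carrier G" "2 \<le> card A"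
    and K: "1 \<le> K" "real (card (A <#> A)) \<le> K * real (card A)"
  shows "real (card L) \<le> 4 * K * log 2 (real (card A))"
proof -
  define n where "n = real (card A)"
  define k where "k = nat \<lceil>log 2 n\<rceil>"
  have n2: "n \<ge> 2" using A by (simp add: n_def)
  then have log1: "1 \<le> log 2 n" by simp
  then have k: "log 2 n \<le> real k" "real k \<le> log 2 n + 1" "k > 0"
    unfolding k_def by linarith+
  have k2: "real k \<le> 2 * log 2 n" using k log1 by linarith
  show ?thesis
  proof (cases "k \<le> card L")
    case True
    have "(real (card L) / real k) ^ k \<le> real (card L choose k)"
      using binomial_ge_n_over_k_pow_k[OF True, where 'a=real] by simp
    also have "\<dots> \<le> real (card (spow A k))"
      using binomial_le_card_spow[OF L A(1,2), of k] by simp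
    also have "\<dots> \<le> K ^ k * n"
      using plunnecke[OF A(1,2) _ K(2)] A unfolding n_def by fastforce
    also have "n \<le> 2 ^ k"
    proof -
      have "n = 2 powr (log 2 n)" using n2 by simp
      also have "\<dots> \<le> 2 powr (real k)" using k by (intro powr_mono) auto
      finally show ?thesis by (simp add: powr_realpow)
    qed
    then have "K ^ k * n \<le> K ^ k * 2 ^ k" using K by (intro mult_left_mono) auto
    also have "\<dots> = (2 * K) ^ k" by (simp add: power_mult_distrib)
    finally have "real (card L) / real k \<le> 2 * K"
      using k K by (subst (asm) power_mono_iff) auto
    then have "real (card L) \<le> 2 * K * real k" using k by (simp add: field_simps)
    also have "\<dots> \<le> 2 * K * (2 * log 2 n)" using k2 K by (intro mult_left_mono) auto
    finally show ?thesis by (simp add: n_def)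
  next
    case False
    then have "real (card L) \<le> 2 * log 2 n" using k2 by linarith
    also have "\<dots> \<le> 4 * K * log 2 n" using K log1 by (intro mult_right_mono) auto
    finally show ?thesis by (simp add: n_def)
  qed
qed

lemma two_pow_card_le_sum:
  assumes "dissociated G L" "L \<subseteq> A" "finite A" "A \<subseteq> carrier G"
  shows "2 ^ card L \<le> (\<Sum>k\<le>card L. card (spow A k))"
proof -
  have "2 ^ card L = (\<Sum>k\<le>card L. card L choose k)" by (rule choose_row_sum[symmetric])
  also have "\<dots> \<le> (\<Sum>k\<le>card L. card (spow A k))"
    by (intro sum_mono binomial_le_card_spow assms)
  finally show ?thesis .
qed

text \<open>
  The translates aA and bA lie in AA and so meet in more than half of the elements: every quotient
  a/b has more than |A|/2 representations, and any two quotients have a common denominator.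
\<close>

lemma small_doubling_subgroup:
  assumes A: "finite A" "A \<subseteq> carrier G" "A \<noteq> {}"
    and K: "2 * card (A <#> A) < 3 * card A"
  shows "diffset A <#> diffset A \<subseteq> diffset A" "card (diffset A) \<le> 2 * card A"
proof -
  define R where "R x = {a \<in> A. x \<otimes> a \<in> A}" for x
  have fR: "finite (R x)" for x using A by (simp add: R_def)
  have R: "2 * card (R x) > card A" if "x \<in> diffset A" for x
  proof -
    obtain a b where ab: "a \<in> A" "b \<in> A" "x = a \<otimes> inv b"
      using \<open>x \<in> diffset A\<close> by (auto elim!: set_multE)
    have c: "a \<in> carrier G" "b \<in> carrier G" "x \<in> carrier G" using ab A by auto
    let ?a = "(\<lambda>y. a \<otimes> y) ` A" and ?b = "(\<lambda>y. b \<otimes> y) ` A"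
    have "?a \<union> ?b \<subseteq> A <#> A" using ab by (auto intro: set_multI)
    then have "card (?a \<union> ?b) \<le> card (A <#> A)" using A by (intro card_mono) auto
    moreover have "card ?a + card ?b = card (?a \<union> ?b) + card (?a \<inter> ?b)"
      using A by (intro card_Un_Int) auto
    moreover have "card ?a = card A" "card ?b = card A" using c A by auto
    moreover have "card (?a \<inter> ?b) \<le> card (R x)"
    proof -
      have "?a \<inter> ?b \<subseteq> (\<lambda>y. a \<otimes> y) ` R x"
      proof
        fix z assume "z \<in> ?a \<inter> ?b"
        then obtain y y' where y: "y \<in> A" "y' \<in> A" "z = a \<otimes> y" "z = b \<otimes> y'" by auto
        have cy: "y \<in> carrier G" "y' \<in> carrier G" using y A by auto
        have "b \<otimes> (x \<otimes> y) = b \<otimes> inv b \<otimes> (a \<otimes> y)"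
          using c cy by (simp only: ab m_closed inv_closed m_ac)
        then have "b \<otimes> (x \<otimes> y) = b \<otimes> y'" using c cy y by simp
        then have "x \<otimes> y = y'" using c cy by simp
        then show "z \<in> (\<lambda>y. a \<otimes> y) ` R x" using y by (auto simp: R_def)
      qed
      then have "card (?a \<inter> ?b) \<le> card ((\<lambda>y. a \<otimes> y) ` R x)" using fR by (intro card_mono) auto
      also have "\<dots> \<le> card (R x)" by (rule card_image_le[OF fR])
      finally show ?thesis .
    qed
    ultimately show ?thesis using K by linarith
  qed
  have div: "x \<otimes> inv y \<in> diffset A" if xy: "x \<in> diffset A" "y \<in> diffset A" for x y
  proof -
    have c: "x \<in> carrier G" "y \<in> carrier G" using xy A by (auto elim!: set_multE)
    have "card (R x \<union> R y) \<le> card A" using A by (intro card_mono) (auto simp: R_def)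
    moreover have "card (R x) + card (R y) = card (R x \<union> R y) + card (R x \<inter> R y)"
      using fR by (intro card_Un_Int) auto
    ultimately have "card (R x \<inter> R y) > 0" using R[OF xy(1)] R[OF xy(2)] by linarith
    then obtain a where a: "a \<in> A" "x \<otimes> a \<in> A" "y \<otimes> a \<in> A"
      by (auto simp: card_gt_0_iff R_def)
    have ca: "a \<in> carrier G" using a A by auto
    have "(x \<otimes> a) \<otimes> inv (y \<otimes> a) = (a \<otimes> inv a) \<otimes> (x \<otimes> inv y)"
      using c ca by (simp only: inv_mult m_closed inv_closed m_ac)
    then have "x \<otimes> inv y = (x \<otimes> a) \<otimes> inv (y \<otimes> a)" using c ca by simp
    then show ?thesis using a by (auto intro!: set_multI)
  qed
  show "diffset A <#> diffset A \<subseteq> diffset A"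
  proof
    fix z assume "z \<in> diffset A <#> diffset A"
    then obtain x y where xy: "x \<in> diffset A" "y \<in> diffset A" "z = x \<otimes> y"
      by (blast elim: set_multE)
    have "inv y \<in> diffset A" using inv_diffset[OF A(2)] xy by blast
    moreover have "y \<in> carrier G" using xy A by (auto elim!: set_multE)
    ultimately show "z \<in> diffset A" using div[of x "inv y"] xy by simp
  qed
  \<comment> \<open>Double counting: the pairs \<open>(a, x \<otimes> a)\<close> for different
    quotients \<open>x\<close> are different elements of \<open>A \<times> A\<close>, and each
    \<open>x\<close> accounts for more than \<open>|A| / 2\<close> of them.\<close>
  have "card (SIGMA x:diffset A. R x) \<le> card (A \<times> A)"
  proof (rule card_inj_on_le)
    show "inj_on (\<lambda>(x, a). (a, x \<otimes> a)) (SIGMA x:diffset A. R x)"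
    proof (rule inj_onI)
      fix u v assume uv: "u \<in> (SIGMA x:diffset A. R x)" "v \<in> (SIGMA x:diffset A. R x)"
        "(\<lambda>(x, a). (a, x \<otimes> a)) u = (\<lambda>(x, a). (a, x \<otimes> a)) v"
      obtain x a y b where e: "u = (x, a)" "v = (y, b)" by (cases u, cases v)
      then have h: "x \<in> diffset A" "y \<in> diffset A" "a \<in> R x" "b = a" "x \<otimes> a = y \<otimes> a"
        using uv by auto
      then have "x \<in> carrier G" "y \<in> carrier G" "a \<in> carrier G"
        using A by (auto elim!: set_multE simp: R_def)
      then show "u = v" using h e by (simp add: right_cancel)
    qed
  qed (use A in \<open>auto simp: R_def\<close>)
  then have "(\<Sum>x\<in>diffset A. card (R x)) \<le> card A * card A"
    using A fR by (simp add: card_SigmaI card_cartesian_product)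
  moreover have "(\<Sum>x\<in>diffset A. card A) \<le> (\<Sum>x\<in>diffset A. 2 * card (R x))"
    using R by (intro sum_mono) (simp add: less_imp_le)
  ultimately have "card (diffset A) * card A \<le> 2 * (card A * card A)"
    by (simp only: sum_distrib_left[symmetric] sum_constant of_nat_id)
  then have "card (diffset A) * card A \<le> (2 * card A) * card A" by (simp only: mult.assoc)
  moreover have "0 < card A" using A by (simp add: card_gt_0_iff)
  ultimately show "card (diffset A) \<le> 2 * card A" by (simp only: mult_le_cancel2)
qed

text \<open>\<open>A\<close> lies in one coset of the subgroup \<open>diffset A\<close>, so every
  \<open>spow A n\<close> lies in one coset too and has at most \<open>2 |A|\<close> elements,
  whatever \<open>n\<close> is. Subsets of \<open>L\<close> have only \<open>|L| + 1\<close>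
  possible sizes.\<close>

lemma dissociated_bound_small_doubling:
  assumes L: "dissociated G L" "L \<subseteq> A" and A: "finite A" "A \<subseteq> carrier G" "A \<noteq> {}"
    and K: "2 * card (A <#> A) < 3 * card A"
  shows "2 ^ card L \<le> (card L + 1) * (2 * card A)"
proof -
  define H where "H = diffset A"
  have H: "H \<subseteq> carrier G" "finite H" "H <#> H \<subseteq> H" "card H \<le> 2 * card A"
    using small_doubling_subgroup[OF A K] A by (auto simp: H_def)
  obtain a where a: "a \<in> A" using A by auto
  have ac: "a \<in> carrier G" using a A by auto
  have aH: "A \<subseteq> {a} <#> H"
  proof
    fix x assume x: "x \<in> A"
    then have "x \<in> carrier G" using A by auto
    then have "x = a \<otimes> (x \<otimes> inv a)" using ac by (metis inv_closed inv_solve_left m_closed m_comm)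
    then show "x \<in> {a} <#> H" using x a unfolding H_def by (metis imageI insertI1 set_multI)
  qed
  have one: "\<one> \<in> H" using a ac set_multI[of a A "inv a" "m_inv G ` A"] by (simp add: H_def)
  have spH: "spow H n \<subseteq> H" for n
  proof (induction n)
    case (Suc n)
    then have "spow H (Suc n) \<subseteq> H <#> H" by (simp add: mono_set_mult)
    then show ?case using H by auto
  qed (simp add: one)
  have card_sp: "card (spow A n) \<le> 2 * card A" for n
  proof -
    have "spow A n \<subseteq> spow ({a} <#> H) n" by (rule spow_mono[OF aH])
    also have "\<dots> = spow {a} n <#> spow H n" using ac H by (simp add: spow_mult_distrib)
    also have "\<dots> \<subseteq> spow {a} n <#> H" using spH by (intro mono_set_mult) auto
    finally have "card (spow A n) \<le> card (spow {a} n <#> H)" using H by (intro card_mono) auto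
    also have "\<dots> \<le> card (spow {a} n) * card H" using H by (intro card_set_mult_le) auto
    also have "card (spow {a} n) \<le> 1"
    proof (induction n)
      case (Suc n)
      have "card (spow {a} (Suc n)) \<le> card (spow {a} n) * card {a}"
        by (simp only: spow.simps) (intro card_set_mult_le, auto)
      then show ?case using Suc by simp
    qed simp
    then have "card (spow {a} n) * card H \<le> card H" by simp
    finally show ?thesis using H by linarith
  qed
  have "2 ^ card L \<le> (\<Sum>k\<le>card L. card (spow A k))"
    by (rule two_pow_card_le_sum[OF L A(1,2)])
  also have "\<dots> \<le> (\<Sum>k\<le>card L. 2 * card A)" by (intro sum_mono card_sp)
  also have "\<dots> = (card L + 1) * (2 * card A)" by simp
  finally show ?thesis .
qed

section \<open>Boxes and Chang's covering argument\<close>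

text \<open>\<open>spow (symm F) n\<close> plays the part of a box spanned by \<open>F\<close>: the
  products of at most \<open>n\<close> factors from \<open>F\<close> and its inverses. In this
  encoding the laws of \<open>spow\<close> add up side lengths, and the \<open>\<one>\<close> makes
  the sets nested.\<close>

definition symm :: "'a set \<Rightarrow> 'a set" where
  "symm F = insert \<one> (F \<union> m_inv G ` F)"

lemma symm_closed [simp]: "F \<subseteq> carrier G \<Longrightarrow> symm F \<subseteq> carrier G"
  by (auto simp: symm_def)

lemma finite_symm [simp]: "finite F \<Longrightarrow> finite (symm F)"
  by (simp add: symm_def)

lemma one_in_symm [simp]: "\<one> \<in> symm F"
  by (simp add: symm_def)

lemma symm_mono: "F \<subseteq> F' \<Longrightarrow> symm F \<subseteq> symm F'"
  by (auto simp: symm_def)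

lemma inv_symm [simp]: "F \<subseteq> carrier G \<Longrightarrow> m_inv G ` symm F = symm F"
  by (auto simp: symm_def image_Un)

text \<open>Commutativity gathers the factors \<open>f\<close> and \<open>inv f\<close> into one
  power with exponent between \<open>-n\<close> and \<open>n\<close>, so each generator contributes
  at most \<open>2n + 1\<close> choices.\<close>

lemma card_spow_symm:
  assumes "finite F" "F \<subseteq> carrier G"
  shows "card (spow (symm F) n) \<le> (2 * n + 1) ^ card F"
  using assms
proof (induction F rule: finite_induct)
  case empty
  have "spow {\<one>} n = {\<one>}" by (induction n) auto
  then show ?case by (simp add: symm_def)
next
  case (insert f F)
  then have f: "f \<in> carrier G" and F: "F \<subseteq> carrier G" by auto
  define Z where "Z n = (\<lambda>i::int. f [^] i) ` {- int n .. int n}" for n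
  have Zc: "Z n \<subseteq> carrier G" "finite (Z n)" for n using f by (auto simp: Z_def)
  have sub: "spow (symm (insert f F)) n \<subseteq> Z n <#> spow (symm F) n" for n
  proof (induction n)
    case 0
    then show ?case by (simp add: Z_def set_mult_def)
  next
    case (Suc n)
    show ?case
    proof
      fix w assume "w \<in> spow (symm (insert f F)) (Suc n)"
      then obtain x s where xs: "x \<in> spow (symm (insert f F)) n" "s \<in> symm (insert f F)" "w = x \<otimes> s"
        by (auto elim!: set_multE)
      then obtain i q where iq: "i \<in> {- int n .. int n}" "q \<in> spow (symm F) n" "x = f [^] i \<otimes> q"
        using Suc by (auto elim!: set_multE simp: Z_def)
      have qc: "q \<in> carrier G" using iq(2) spow_closed[OF symm_closed[OF F], of n] by blast
      have sc: "s \<in> carrier G" using xs f F by (auto simp: symm_def)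
      have mono: "spow (symm F) n \<subseteq> spow (symm F) (Suc n)"
        using F by (intro spow_mono_exp) auto
      consider "s \<in> symm F" | "s = f" | "s = inv f" using xs by (auto simp: symm_def)
      then show "w \<in> Z (Suc n) <#> spow (symm F) (Suc n)"
      proof cases
        case 1
        have "w = f [^] i \<otimes> (q \<otimes> s)" using xs iq qc sc f by (simp add: m_assoc)
        moreover have "q \<otimes> s \<in> spow (symm F) (Suc n)" using iq 1 by (auto intro: set_multI)
        moreover have "f [^] i \<in> Z (Suc n)" using iq by (auto simp: Z_def)
        ultimately show ?thesis by (metis set_multI)
      next
        case 2
        have "w = (f [^] i \<otimes> f) \<otimes> q" using xs iq qc f 2 by (simp add: m_ac)
        also have "f [^] i \<otimes> f = f [^] (i + 1)" using int_pow_mult[OF f, of i 1] f by simp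
        finally show ?thesis using iq mono by (auto simp: Z_def intro!: set_multI)
      next
        case 3
        have "w = (f [^] i \<otimes> inv f) \<otimes> q" using xs iq qc f 3 by (simp add: m_ac)
        also have "f [^] i \<otimes> inv f = f [^] (i - 1)" using int_pow_diff[OF f, of i 1] f by simp
        finally show ?thesis using iq mono by (auto simp: Z_def intro!: set_multI)
      qed
    qed
  qed
  have "card (spow (symm (insert f F)) n) \<le> card (Z n <#> spow (symm F) n)"
    using insert Zc by (intro card_mono sub finite_set_mult) auto
  also have "\<dots> \<le> card (Z n) * card (spow (symm F) n)"
    using insert Zc by (intro card_set_mult_le) auto
  also have "\<dots> \<le> (2 * n + 1) * (2 * n + 1) ^ card F"
  proof (rule mult_le_mono)
    have "card (Z n) \<le> card {- int n .. int n}" unfolding Z_def by (rule card_image_le) simp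
    then show "card (Z n) \<le> 2 * n + 1" by simp
    show "card (spow (symm F) n) \<le> (2 * n + 1) ^ card F" using insert F by simp
  qed
  finally show ?case using insert by simp
qed

text \<open>Starting from \<open>P = T\<close>, multiply \<open>P\<close> by sets
  \<open>Y \<subseteq> A\<close> of \<open>M\<close> elements whose translates \<open>yP\<close> are
  disjoint. A round multiplies \<open>|P|\<close> by \<open>M \<ge> 2K\<close>, while Pluennecke
  allows only a factor \<open>K\<close>, so there are few rounds. When no further round is possible,
  a maximal \<open>Y\<close> has fewer than \<open>M\<close> elements and every \<open>aP\<close>
  meets \<open>PY\<close>.\<close>

lemma chang_covering:
  assumes A: "finite A" "A \<subseteq> carrier G" and T: "T \<subseteq> A" "T \<noteq> {}"
    and K: "1 \<le> K" "real (card (A <#> A)) \<le> K * real (card A)"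
    and M: "2 * K \<le> real M" and R: "real (card A) \<le> R * real (card T)"
  obtains j F where "2 ^ j \<le> K * R" "finite F" "F \<subseteq> carrier G" "card F \<le> M * (j + 1)"
    "A \<subseteq> diffset T <#> spow (symm F) (2 * j + 1)"
proof -
  have fT: "finite T" "T \<subseteq> carrier G" "card T > 0" "A \<noteq> {}"
    using A T by (auto simp: card_gt_0_iff intro: finite_subset)
  \<comment> \<open>The state after \<open>j\<close> rounds: \<open>F\<close> collects the elements
    used, and \<open>P\<close> consists of products of \<open>j + 1\<close> elements of
    \<open>A\<close>, the first of them from \<open>T\<close>.\<close>
  define st where "st j P F \<longleftrightarrow> finite P \<and> P \<subseteq> spow A (Suc j) \<and> finite F \<and> F \<subseteq> A \<and> card F \<le> M * j
    \<and> P \<subseteq> T <#> spow (symm F) j \<and> card P = M ^ j * card T" for j P F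
  have st_bound: "2 ^ j \<le> K * R" if "st j P F" for j P F
  proof -
    have "(2 * K) ^ j * real (card T) \<le> real M ^ j * real (card T)"
      using M K by (intro mult_right_mono power_mono) auto
    also have "\<dots> = real (card P)" using that by (simp add: st_def)
    also have "\<dots> \<le> real (card (spow A (Suc j)))"
      using that A unfolding st_def by (meson card_mono finite_spow of_nat_le_iff)
    also have "\<dots> \<le> K ^ Suc j * real (card A)"
      by (rule plunnecke) (use A fT K in auto)
    also have "\<dots> \<le> K ^ Suc j * (R * real (card T))"
      using R K by (intro mult_left_mono) auto
    finally have "K ^ j * 2 ^ j * real (card T) \<le> K ^ j * (K * R) * real (card T)"
      by (simp add: power_mult_distrib algebra_simps)
    then have "K ^ j * 2 ^ j \<le> K ^ j * (K * R)"
      using fT by (subst (asm) mult_le_cancel_right_pos) auto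
    then show ?thesis using K by (subst (asm) mult_le_cancel_left_pos) auto
  qed
  have bounded: "j \<le> nat \<lfloor>K * R\<rfloor>" if "\<exists>P F. st j P F" for j
  proof -
    have "real j \<le> 2 ^ j" by (metis less_imp_le of_nat_less_two_power)
    also have "\<dots> \<le> K * R" using that st_bound by blast
    finally show ?thesis by linarith
  qed
  have "st 0 T {}" using T fT A by (auto simp: st_def)
  then have ex0: "\<exists>P F. st 0 P F" by blast
  define j where "j = (GREATEST j. \<exists>P F. st j P F)"
  have "\<exists>P F. st j P F" unfolding j_def
    by (rule GreatestI_nat[where P = "\<lambda>j. \<exists>P F. st j P F" and k = 0, OF ex0]) (use bounded in blast)
  then obtain P F where st: "st j P F" by blast
  have max: "\<not> st (Suc j) P' F'" for P' F'
    using Greatest_le_nat[where P = "\<lambda>j. \<exists>P F. st j P F" and k = "Suc j" and b = "nat \<lfloor>K * R\<rfloor>"] bounded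
    unfolding j_def by fastforce
  have P: "finite P" "P \<subseteq> carrier G" "P \<noteq> {}" "P \<subseteq> spow A (Suc j)" "P \<subseteq> T <#> spow (symm F) j"
      and F: "finite F" "F \<subseteq> A" "card F \<le> M * j" "F \<subseteq> carrier G" and cP: "card P = M ^ j * card T"
  proof -
    have "M > 0" using M K by (cases M) auto
    then have "card P > 0" using st fT by (simp add: st_def)
    then show "P \<noteq> {}" by auto
    show "P \<subseteq> carrier G" using st spow_closed[OF A(2), of "Suc j"] unfolding st_def by blast
  qed (use st A in \<open>auto simp: st_def\<close>)
  \<comment> \<open>Disjointness of the translates is expressed by \<open>|PY| = |P| |Y|\<close>.
    The cap \<open>M\<close> keeps the final, incomplete round as small as the others.\<close>
  define Ys where "Ys = {Y \<in> Pow A. card Y \<le> M \<and> card (P <#> Y) = card P * card Y}"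
  have "finite Ys" "{} \<in> Ys" using A by (auto simp: Ys_def set_mult_def)
  then obtain Y where Y: "Y \<in> Ys" and Ymax: "\<And>Y'. Y' \<in> Ys \<Longrightarrow> card Y' \<le> card Y"
    using finite_has_maximal[of "card ` Ys"] by (metis (no_types, lifting) empty_iff finite_imageI imageE image_eqI leI less_imp_le)
  have fY: "finite Y" "Y \<subseteq> carrier G" "Y \<subseteq> A" "card Y \<le> M" "card (P <#> Y) = card P * card Y"
    using Y A by (auto simp: Ys_def intro: finite_subset)
  define S where "S = symm (F \<union> Y)"
  have S: "S \<subseteq> carrier G" "finite S" "\<one> \<in> S" "m_inv G ` S = S" "symm F \<subseteq> S" "Y \<subseteq> S"
    using fY F by (simp_all add: S_def symm_mono) (auto simp: symm_def)
  have PS: "P \<subseteq> T <#> spow S j"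
    using P(5) mono_set_mult[OF order_refl spow_mono[OF S(5)]] by blast
  \<comment> \<open>A full set \<open>Y\<close> would complete one more round, against the
    maximality of \<open>j\<close>.\<close>
  have Yne: "card Y \<noteq> M"
  proof
    assume YM: "card Y = M"
    have "st (Suc j) (P <#> Y) (F \<union> Y)"
      unfolding st_def
    proof (intro conjI)
      show "P <#> Y \<subseteq> spow A (Suc (Suc j))"
        using mono_set_mult[OF P(4) fY(3)] by (simp only: spow.simps)
      show "card (F \<union> Y) \<le> M * Suc j"
        using card_Un_le[of F Y] F YM by simp
      have "P <#> Y \<subseteq> (T <#> spow S j) <#> S"
        using PS S by (intro mono_set_mult) auto
      then show "P <#> Y \<subseteq> T <#> spow (symm (F \<union> Y)) (Suc j)"
        using S fT by (simp add: set_mult_assoc S_def[symmetric])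
      show "card (P <#> Y) = M ^ Suc j * card T" using fY YM cP by simp
    qed (use P F fY in auto)
    then show False using max by blast
  qed
  have cover: "A \<subseteq> diffset P <#> Y"
  proof
    fix a assume a: "a \<in> A"
    then have ac: "a \<in> carrier G" using A by auto
    show "a \<in> diffset P <#> Y"
    proof (cases "a \<in> Y")
      case True
      obtain p where "p \<in> P" using P by auto
      then have "\<one> \<in> diffset P" using set_multI[of p P "inv p" "m_inv G ` P"] P by auto
      then show ?thesis using True ac set_multI[of \<one> "diffset P" a Y] by simp
    next
      case False
      let ?t = "(\<lambda>p. a \<otimes> p) ` P"
      have "?t \<inter> (P <#> Y) \<noteq> {}"
      proof
        assume disj: "?t \<inter> (P <#> Y) = {}"
        have "P <#> insert a Y = ?t \<union> (P <#> Y)"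
          using P ac by (auto simp: set_mult_def image_iff m_comm subset_iff)
        then have "card (P <#> insert a Y) = card P * card (insert a Y)"
          using disj P ac fY False by (simp add: card_Un_disjoint)
        moreover have "card (insert a Y) \<le> M" using False fY Yne by simp
        ultimately have "insert a Y \<in> Ys" using fY a by (auto simp: Ys_def)
        then show False using Ymax[of "insert a Y"] False fY by simp
      qed
      then obtain p w where pw: "p \<in> P" "a \<otimes> p = w" "w \<in> P <#> Y" by blast
      from pw(3) obtain p' y where "p' \<in> P" "y \<in> Y" "w = p' \<otimes> y" by (rule set_multE)
      with pw have p: "p \<in> P" "p' \<in> P" "y \<in> Y" "a \<otimes> p = p' \<otimes> y" by auto
      then have c: "p \<in> carrier G" "p' \<in> carrier G" "y \<in> carrier G" using P fY by auto
      have "a = (a \<otimes> p) \<otimes> inv p" using c ac by (simp add: m_assoc)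
      also have "\<dots> = (p' \<otimes> inv p) \<otimes> y" using c p by (simp add: m_ac)
      finally show ?thesis using p by (auto intro!: set_multI)
    qed
  qed
  have "m_inv G ` P \<subseteq> m_inv G ` (T <#> spow S j)" using PS by blast
  also have "\<dots> = m_inv G ` T <#> spow S j" using S fT by (simp add: inv_set_mult inv_spow)
  finally have "diffset P \<subseteq> (T <#> spow S j) <#> (m_inv G ` T <#> spow S j)"
    using PS by (intro mono_set_mult)
  also have "\<dots> = diffset T <#> (spow S j <#> spow S j)"
    using S fT by (simp add: set_mult_assoc set_mult_left_commute[of "spow S j"])
  also have "\<dots> = diffset T <#> spow S (j + j)" using S by (simp add: spow_add)
  finally have "diffset P <#> Y \<subseteq> (diffset T <#> spow S (j + j)) <#> S"
    using S(6) by (rule mono_set_mult)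
  \<comment> \<open>The side is \<open>j\<close> for each of \<open>P\<close> and its inverse set,
    and one for \<open>Y\<close>.\<close>
  also have "\<dots> = diffset T <#> spow S (2 * j + 1)"
    using S fT by (simp add: set_mult_assoc mult_2)
  finally have AS: "A \<subseteq> diffset T <#> spow (symm (F \<union> Y)) (2 * j + 1)"
    using cover by (auto simp: S_def)
  show thesis
  proof (rule that[OF st_bound[OF st] _ _ _ AS])
    show "card (F \<union> Y) \<le> M * (j + 1)" using card_Un_le[of F Y] F fY by simp
  qed (use F fY in auto)
qed

text \<open>Once \<open>|L|\<close> factors are absorbed into a box of side \<open>5N |L|\<close>,
  each generator has \<open>2 (5N |L|) + 1\<close> possible exponents. This is the base of the
  power, and the number of generators is its exponent.\<close>

lemma dissociated_bound_covering:
  assumes L: "dissociated G L" "L \<subseteq> A" and A: "finite A" "A \<subseteq> carrier G" "A \<noteq> {}"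
    and T: "T \<subseteq> A" "T \<noteq> {}" and T5: "spow (diffset T) 5 \<subseteq> diffset (spow A 2)"
    and F: "finite F" "F \<subseteq> carrier G"
    and cover: "A \<subseteq> diffset T <#> spow (symm F) N"
  shows "2 ^ card L \<le> card (diffset (spow A 2)) * (2 * (card L * (5 * N)) + 1) ^ card F"
proof -
  define W where "W = diffset (spow A 2)"
  define D where "D = diffset T"
  define Q where "Q = spow (symm F) N"
  \<comment> \<open>Adjoining \<open>\<one>\<close> puts the products of subsets of all sizes into
    the one set \<open>spow A' (card L)\<close>. The covering survives, as
    \<open>\<one> \<in> D <#> Q\<close>.\<close>
  define A' where "A' = insert \<one> A"
  have W: "finite W" "W \<subseteq> carrier G" using A by (simp_all add: W_def)
  have D: "D \<subseteq> carrier G" using A T by (auto simp: D_def)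
  have Q: "Q \<subseteq> carrier G" "finite Q" "\<one> \<in> Q" "m_inv G ` Q = Q"
    using F by (auto simp: Q_def inv_spow one_in_spow)
  have A': "A \<subseteq> A'" "A' \<subseteq> carrier G" "finite A'" using A by (auto simp: A'_def)
  have invD: "m_inv G ` D = D" using A T by (auto simp: D_def inv_diffset)
  have one_diff: "\<one> \<in> diffset B" if "B \<noteq> {}" "B \<subseteq> carrier G" for B
  proof -
    obtain b where "b \<in> B" using \<open>B \<noteq> {}\<close> by auto
    then show ?thesis using set_multI[of b B "inv b" "m_inv G ` B"] that by auto
  qed
  have oneD: "\<one> \<in> D" using T A by (auto simp: D_def intro!: one_diff)
  have "A <#> A \<noteq> {}" using A by (auto simp: set_mult_def)
  then have oneW: "\<one> \<in> W" using one_diff[of "A <#> A"] A by (simp add: W_def numeral_2_eq_2)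
  have ADQ: "A \<subseteq> D <#> Q" using cover by (simp add: D_def Q_def)
  have "\<one> \<in> D <#> Q" using set_multI[OF oneD Q(3)] by simp
  then have A'DQ: "A' \<subseteq> D <#> Q" using ADQ by (simp add: A'_def)
  have sA: "spow A 2 \<subseteq> spow (D <#> Q) 2" using ADQ by (rule spow_mono)
  have "m_inv G ` spow A 2 \<subseteq> m_inv G ` spow (D <#> Q) 2" using sA by blast
  also have "\<dots> = spow (D <#> Q) 2" using D Q invD by (simp add: inv_spow inv_set_mult)
  finally have "W <#> A' \<subseteq> (spow (D <#> Q) 2 <#> spow (D <#> Q) 2) <#> (D <#> Q)"
    unfolding W_def using sA A'DQ by (intro mono_set_mult)
  also have "\<dots> = spow (D <#> Q) 5"
  proof -
    have "spow (D <#> Q) (Suc (2 + 2)) = (spow (D <#> Q) 2 <#> spow (D <#> Q) 2) <#> (D <#> Q)"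
      unfolding spow.simps using D Q by (subst spow_add) auto
    then show ?thesis by simp
  qed
  also have "\<dots> = spow D 5 <#> spow Q 5" using D Q by (intro spow_mult_distrib) auto
  also have "\<dots> \<subseteq> W <#> spow Q 5" using T5 by (intro mono_set_mult) (auto simp: D_def W_def)
  finally have step: "W <#> A' \<subseteq> W <#> spow Q 5" .
  have iter: "W <#> spow A' n \<subseteq> W <#> spow (spow Q 5) n" for n
  proof (induction n)
    case (Suc n)
    have "W <#> spow A' (Suc n) = (W <#> spow A' n) <#> A'"
      using W A' by (simp add: set_mult_assoc)
    also have "\<dots> \<subseteq> (W <#> spow (spow Q 5) n) <#> A'" using Suc order_refl by (rule mono_set_mult)
    also have "\<dots> = spow (spow Q 5) n <#> (W <#> A')" using W Q A' by (simp add: set_mult_ac sumset_commute)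
    also have "\<dots> \<subseteq> spow (spow Q 5) n <#> (W <#> spow Q 5)"
      using order_refl step by (rule mono_set_mult)
    also have "\<dots> = W <#> spow (spow Q 5) (Suc n)"
      using W Q by (simp add: set_mult_left_commute)
    finally show ?case .
  qed simp
  have fL: "finite L" using L A by (auto simp: dissociated_def)
  have "finprod G (\<lambda>x. x) ` Pow L \<subseteq> W <#> spow (spow Q 5) (card L)"
  proof
    fix z assume "z \<in> finprod G (\<lambda>x. x) ` Pow L"
    then obtain I where I: "I \<subseteq> L" "z = finprod G (\<lambda>x. x) I" by auto
    then have "z \<in> spow A' (card I)"
      using finprod_in_spow[of I A'] L A' fL by (auto intro: finite_subset)
    also have "\<dots> \<subseteq> spow A' (card L)"
      using A' I fL by (intro spow_mono_exp card_mono) (auto simp: A'_def)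
    finally have zA: "z \<in> spow A' (card L)" .
    moreover have "z \<in> carrier G" using zA spow_closed[OF A'(2)] by blast
    ultimately have "z \<in> W <#> spow A' (card L)" using set_multI[OF oneW zA] by simp
    then show "z \<in> W <#> spow (spow Q 5) (card L)" using iter by blast
  qed
  then have "card (Pow L) \<le> card (W <#> spow (spow Q 5) (card L))"
    using inj_on_subset_products[OF L(1)] W Q by (intro card_inj_on_le) auto
  also have "\<dots> \<le> card W * card (spow (spow Q 5) (card L))"
    using W Q by (intro card_set_mult_le) auto
  also have "spow (spow Q 5) (card L) = spow (symm F) (card L * (5 * N))"
    using F by (simp add: Q_def spow_spow algebra_simps)
  also have "card \<dots> \<le> (2 * (card L * (5 * N)) + 1) ^ card F"
    by (rule card_spow_symm[OF F])
  finally show ?thesis using fL by (simp add: card_Pow W_def)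
qed

end

subsection \<open>Almost periodicity\<close>

text \<open>For \<open>x = -y < 0\<close> this follows from
  \<open>(1 + y) exp x \<le> 1 \<le> 1 + y^3\<close> and the factorisation
  \<open>1 + y^3 = (1 + y) (1 - y + y^2)\<close>.\<close>

lemma exp_le_quadratic:
  fixes x :: real
  assumes "\<bar>x\<bar> \<le> 1"
  shows "exp x \<le> 1 + x + x\<^sup>2"
proof (cases "0 \<le> x")
  case True
  then show ?thesis using assms by (intro exp_bound) auto
next
  case False
  define y where "y = - x"
  have y: "0 < y" "y \<le> 1" using False assms by (auto simp: y_def)
  have "(1 + y) * exp x \<le> exp y * exp x"
    by (intro mult_right_mono exp_ge_add_one_self) auto
  also have "exp y * exp x = 1" by (simp add: y_def flip: exp_add)
  also have "1 \<le> 1 + y ^ 3" using y by simp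
  also have "\<dots> = (1 + y) * (1 + x + x\<^sup>2)" by (simp add: y_def power2_eq_square power3_eq_cube algebra_simps)
  finally show ?thesis using y by (subst (asm) mult_le_cancel_left_pos) auto
qed

text \<open>The exponential-moment method, with counting of tuples in place of probability: the sum
  over all tuples factors into the \<open>l\<close>-th power of a sum over \<open>A\<close>, where
  the mean-zero condition removes the linear term.\<close>

lemma chernoff_upper:
  fixes u :: "'a \<Rightarrow> real"
  assumes A: "finite A" and u: "\<And>a. a \<in> A \<Longrightarrow> \<bar>u a\<bar> \<le> 1" "(\<Sum>a\<in>A. u a) = 0"
    and \<epsilon>: "0 < \<epsilon>" "\<epsilon> \<le> 1"
  shows "real (card {f \<in> {..<l} \<rightarrow>\<^sub>E A. \<epsilon> * real l \<le> (\<Sum>i<l. u (f i))}) \<le> exp (- \<epsilon>\<^sup>2 * real l / 4) * real (card A) ^ l"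
proof -
  define \<Omega> where "\<Omega> = {..<l} \<rightarrow>\<^sub>E A"
  \<comment> \<open>This value minimises \<open>\<beta>^2 - \<beta> \<epsilon>\<close>, and the
    minimum is \<open>-\<epsilon>^2 / 4\<close>.\<close>
  define \<beta> where "\<beta> = \<epsilon> / 2"
  define B where "B = {f \<in> \<Omega>. \<epsilon> * real l \<le> (\<Sum>i<l. u (f i))}"
  have fin: "finite \<Omega>" using A by (simp add: \<Omega>_def finite_PiE)
  have "(\<Sum>a\<in>A. exp (\<beta> * u a)) \<le> (\<Sum>a\<in>A. 1 + \<beta> * u a + \<beta>\<^sup>2)"
  proof (rule sum_mono)
    fix a assume a: "a \<in> A"
    have "\<bar>\<beta> * u a\<bar> \<le> 1 * 1" unfolding abs_mult using u(1)[OF a] \<epsilon>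
      by (intro mult_mono) (auto simp: \<beta>_def)
    then have "exp (\<beta> * u a) \<le> 1 + \<beta> * u a + (\<beta> * u a)\<^sup>2" by (intro exp_le_quadratic) auto
    also have "(\<beta> * u a)\<^sup>2 \<le> \<beta>\<^sup>2"
    proof -
      have "(u a)\<^sup>2 \<le> 1" using u(1)[OF a] by (simp add: abs_square_le_1)
      then show ?thesis by (simp add: power_mult_distrib mult_left_le)
    qed
    finally show "exp (\<beta> * u a) \<le> 1 + \<beta> * u a + \<beta>\<^sup>2" by simp
  qed
  also have "\<dots> = real (card A) * (1 + \<beta>\<^sup>2)"
    using u(2) by (simp add: sum.distrib algebra_simps flip: sum_distrib_left)
  also have "\<dots> \<le> real (card A) * exp (\<beta>\<^sup>2)"
    by (intro mult_left_mono exp_ge_add_one_self) auto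
  finally have one: "(\<Sum>a\<in>A. exp (\<beta> * u a)) \<le> real (card A) * exp (\<beta>\<^sup>2)" .
  have "real (card B) * exp (\<beta> * (\<epsilon> * real l)) = (\<Sum>f\<in>B. exp (\<beta> * (\<epsilon> * real l)))" by simp
  also have "\<dots> \<le> (\<Sum>f\<in>B. exp (\<beta> * (\<Sum>i<l. u (f i))))"
    using \<epsilon> by (intro sum_mono) (auto simp: B_def \<beta>_def)
  also have "\<dots> \<le> (\<Sum>f\<in>\<Omega>. exp (\<beta> * (\<Sum>i<l. u (f i))))"
    using fin by (intro sum_mono2) (auto simp: B_def)
  also have "\<dots> = (\<Sum>f\<in>\<Omega>. \<Prod>i<l. exp (\<beta> * u (f i)))"
    by (simp add: exp_sum sum_distrib_left)
  also have "\<dots> = (\<Prod>i<l. \<Sum>a\<in>A. exp (\<beta> * u a))"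
    unfolding \<Omega>_def using A by (subst prod_sum_PiE) auto
  also have "\<dots> = (\<Sum>a\<in>A. exp (\<beta> * u a)) ^ l" by simp
  also have "\<dots> \<le> (real (card A) * exp (\<beta>\<^sup>2)) ^ l"
    using one by (intro power_mono sum_nonneg) auto
  also have "\<dots> = real (card A) ^ l * exp (\<beta>\<^sup>2 * real l)"
    by (simp add: power_mult_distrib exp_of_nat_mult mult.commute)
  finally have *: "real (card B) * exp (\<beta> * (\<epsilon> * real l)) \<le> real (card A) ^ l * exp (\<beta>\<^sup>2 * real l)" .
  have "real (card B) = (real (card B) * exp (\<beta> * (\<epsilon> * real l))) * exp (- (\<beta> * (\<epsilon> * real l)))"
    by (simp add: mult.assoc flip: exp_add)
  also have "\<dots> \<le> (real (card A) ^ l * exp (\<beta>\<^sup>2 * real l)) * exp (- (\<beta> * (\<epsilon> * real l)))"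
    using * by (intro mult_right_mono) auto
  also have "\<dots> = exp (\<beta>\<^sup>2 * real l - \<beta> * (\<epsilon> * real l)) * real (card A) ^ l"
    by (simp add: exp_diff exp_minus field_simps)
  also have "\<beta>\<^sup>2 * real l - \<beta> * (\<epsilon> * real l) = - \<epsilon>\<^sup>2 * real l / 4"
    by (simp add: \<beta>_def power2_eq_square field_simps)
  finally show ?thesis by (simp add: B_def \<Omega>_def)
qed

lemma chernoff:
  fixes u :: "'a \<Rightarrow> real"
  assumes A: "finite A" and u: "\<And>a. a \<in> A \<Longrightarrow> \<bar>u a\<bar> \<le> 1" "(\<Sum>a\<in>A. u a) = 0"
    and \<epsilon>: "0 < \<epsilon>" "\<epsilon> \<le> 1"
  shows "real (card {f \<in> {..<l} \<rightarrow>\<^sub>E A. \<epsilon> * real l \<le> \<bar>\<Sum>i<l. u (f i)\<bar>}) \<le> 2 * exp (- \<epsilon>\<^sup>2 * real l / 4) * real (card A) ^ l"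
proof -
  let ?B = "\<lambda>v. {f \<in> {..<l} \<rightarrow>\<^sub>E A. \<epsilon> * real l \<le> (\<Sum>i<l. v (f i))}"
  have fin: "finite ({..<l} \<rightarrow>\<^sub>E A)" using A by (simp add: finite_PiE)
  have "{f \<in> {..<l} \<rightarrow>\<^sub>E A. \<epsilon> * real l \<le> \<bar>\<Sum>i<l. u (f i)\<bar>} \<subseteq> ?B u \<union> ?B (\<lambda>a. - u a)"
  proof
    fix f assume "f \<in> {f \<in> {..<l} \<rightarrow>\<^sub>E A. \<epsilon> * real l \<le> \<bar>\<Sum>i<l. u (f i)\<bar>}"
    then show "f \<in> ?B u \<union> ?B (\<lambda>a. - u a)"
      by (cases "0 \<le> (\<Sum>i<l. u (f i))") (simp_all add: sum_negf)
  qed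
  then have "card {f \<in> {..<l} \<rightarrow>\<^sub>E A. \<epsilon> * real l \<le> \<bar>\<Sum>i<l. u (f i)\<bar>} \<le> card (?B u \<union> ?B (\<lambda>a. - u a))"
    using fin by (intro card_mono) auto
  also have "\<dots> \<le> card (?B u) + card (?B (\<lambda>a. - u a))" by (rule card_Un_le)
  finally show ?thesis
    using chernoff_upper[of A u \<epsilon> l] chernoff_upper[of A "\<lambda>a. - u a" \<epsilon> l] assms
    by (simp add: sum_negf)
qed

context comm_group
begin

text \<open>
  The Croot--Sisask argument: for most tuples f in A, the proportion of the z f(i) lying in AA is
  close, for all but few z, to the proportion g(z) of a in A with za in AA. By pigeonhole many
  translates by elements y of A send such a tuple to one and the same tuple, and g is nearly
  invariant under the quotients of these y. Since g = 1 on A, products of few such quotients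
  cannot leave the set of quotients of A and the support of g.
\<close>

lemma croot_sisask:
  assumes A: "finite A" "A \<subseteq> carrier G" "A \<noteq> {}"
    and K: "1 \<le> K" "real (card (A <#> A)) \<le> K * real (card A)"
    and l: "44 * K ^ 3 * exp (- real l / 484) \<le> 1"
  obtains T where "T \<subseteq> A" "T \<noteq> {}" "real (card A) \<le> 2 * K ^ l * real (card T)"
    "spow (diffset T) 5 \<subseteq> diffset (spow A 2)"
proof -
  define n where "n = real (card A)"
  define S where "S = A <#> A"
  define W where "W = S <#> m_inv G ` A"
  define g where "g z = real (card {a \<in> A. z \<otimes> a \<in> S}) / n" for z
  define u where "u z a = of_bool (z \<otimes> a \<in> S) - g z" for z a
  \<comment> \<open>Chosen for products of five quotients: each quotient costs \<open>2 / 11\<close>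
    in the value of \<open>g\<close> and \<open>2n / 11\<close> exceptional points, and
    \<open>10 / 11 < 1\<close>. The tail exponent \<open>\<epsilon>^2 l / 4\<close> becomes
    \<open>l / 484\<close>.\<close>
  define \<epsilon> :: real where "\<epsilon> = 1 / 11"
  define Bad where "Bad f = {z \<in> carrier G. \<epsilon> * real l \<le> \<bar>\<Sum>i<l. u z (f i)\<bar>}" for f
  define \<Omega> where "\<Omega> = {..<l} \<rightarrow>\<^sub>E A"
  have n0: "n > 0" using A by (simp add: n_def card_gt_0_iff)
  have S: "S \<subseteq> carrier G" "finite S" using A by (auto simp: S_def)
  have W: "W \<subseteq> carrier G" "finite W" using A S by (auto simp: W_def)
  have f\<Omega>: "finite \<Omega>" "real (card \<Omega>) = n ^ l"
    using A by (auto simp: \<Omega>_def finite_PiE card_PiE n_def)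
  have K1: "K ^ 3 \<ge> 1" using K by (simp add: one_le_power)
  have l0: "l > 0"
  proof (rule ccontr)
    assume "\<not> l > 0"
    then have "44 * K ^ 3 \<le> 1" using l by simp
    then show False using K1 by linarith
  qed
  have WI: "z \<in> W" if "z \<in> carrier G" "a \<in> A" "z \<otimes> a \<in> S" for z a
  proof -
    have "a \<in> carrier G" using that A by auto
    then have "z = (z \<otimes> a) \<otimes> inv a" using that by (simp add: m_assoc)
    then show ?thesis using that unfolding W_def by (metis imageI set_multI)
  qed
  have g0: "0 \<le> g z" "g z \<le> 1" for z
  proof -
    have "card {a \<in> A. z \<otimes> a \<in> S} \<le> card A" using A by (intro card_mono) auto
    then show "0 \<le> g z" "g z \<le> 1" using n0 by (auto simp: g_def n_def)
  qed
  have gW: "g z = 0" if "z \<in> carrier G" "z \<notin> W" for z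
  proof -
    have "{a \<in> A. z \<otimes> a \<in> S} = {}" using WI that by auto
    then show ?thesis by (simp only: g_def card.empty of_nat_0 div_0)
  qed
  have gA: "g z = 1" if "z \<in> A" for z
  proof -
    have "{a \<in> A. z \<otimes> a \<in> S} = A" using that by (auto simp: S_def intro: set_multI)
    then show ?thesis using n0 by (simp add: g_def n_def)
  qed
  have u1: "\<bar>u z a\<bar> \<le> 1" for z a using g0[of z] by (auto simp: u_def of_bool_def)
  have u_sum: "(\<Sum>a\<in>A. u z a) = 0" for z
  proof -
    have "(\<Sum>a\<in>A. (of_bool (z \<otimes> a \<in> S) :: real)) = real (card {a \<in> A. z \<otimes> a \<in> S})"
      using A by (simp add: of_bool_def sum.If_cases Int_def)
    then show ?thesis using n0 by (simp add: u_def sum_subtractf g_def n_def)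
  qed
  \<comment> \<open>Outside \<open>W\<close> both the indicator and \<open>g\<close> vanish, so the
    deviation is zero; because \<open>l > 0\<close>, this does not count as bad. Hence
    \<open>Bad f\<close> is finite.\<close>
  have BadW: "Bad f \<subseteq> W" if "f \<in> \<Omega>" for f
  proof
    fix z assume z: "z \<in> Bad f"
    show "z \<in> W"
    proof (rule ccontr)
      assume "z \<notin> W"
      then have "u z (f i) = 0" if "i < l" for i
        using WI[of z "f i"] gW[of z] z \<open>f \<in> \<Omega>\<close> that by (auto simp: u_def Bad_def \<Omega>_def PiE_iff)
      then have "(\<Sum>i<l. u z (f i)) = 0" by simp
      then have "\<epsilon> * real l \<le> 0" using z by (simp add: Bad_def)
      then show False using l0 by (simp add: \<epsilon>_def)
    qed
  qed
  define e where "e = exp (- real l / 484)"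
  have cW: "real (card W) \<le> K ^ 3 * n"
  proof -
    have "W = spow A 2 <#> m_inv G ` spow A 1"
      using A by (simp add: W_def S_def numeral_2_eq_2)
    then show ?thesis using card_sum_diff_le[OF A K(2), of 2 1] by (simp add: n_def)
  qed
  have bad_z: "real (card {f \<in> \<Omega>. z \<in> Bad f}) \<le> 2 * e * n ^ l" if "z \<in> W" for z
  proof -
    have "{f \<in> \<Omega>. z \<in> Bad f} = {f \<in> {..<l} \<rightarrow>\<^sub>E A. \<epsilon> * real l \<le> \<bar>\<Sum>i<l. u z (f i)\<bar>}"
      using that W by (auto simp: \<Omega>_def Bad_def)
    then have "real (card {f \<in> \<Omega>. z \<in> Bad f}) \<le> 2 * exp (- \<epsilon>\<^sup>2 * real l / 4) * real (card A) ^ l"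
      using chernoff[OF A(1) u1 u_sum, of \<epsilon> l z] by (simp add: \<epsilon>_def)
    then show ?thesis by (simp add: e_def \<epsilon>_def n_def power2_eq_square)
  qed
  \<comment> \<open>The pairs \<open>(f, z)\<close> with \<open>z\<close> bad for \<open>f\<close>
    are counted in both orders; for each of the at most \<open>K^3 n\<close> points of
    \<open>W\<close> the tail bound limits the tuples.\<close>
  have "(\<Sum>f\<in>\<Omega>. card (Bad f)) = (\<Sum>f\<in>\<Omega>. \<Sum>z\<in>W. if z \<in> Bad f then 1 else 0)"
  proof (rule sum.cong)
    fix f assume "f \<in> \<Omega>"
    then have "W \<inter> {z. z \<in> Bad f} = Bad f" using BadW by auto
    then show "card (Bad f) = (\<Sum>z\<in>W. if z \<in> Bad f then 1 else 0)"
      using W by (simp add: sum.If_cases)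
  qed simp
  also have "\<dots> = (\<Sum>z\<in>W. \<Sum>f\<in>\<Omega>. if z \<in> Bad f then 1 else 0)" by (rule sum.swap)
  also have "\<dots> = (\<Sum>z\<in>W. card {f \<in> \<Omega>. z \<in> Bad f})"
    using f\<Omega> by (simp add: sum.If_cases Int_def)
  finally have "real (\<Sum>f\<in>\<Omega>. card (Bad f)) = real (\<Sum>z\<in>W. card {f \<in> \<Omega>. z \<in> Bad f})"
    by (rule arg_cong)
  then have "(\<Sum>f\<in>\<Omega>. real (card (Bad f))) = (\<Sum>z\<in>W. real (card {f \<in> \<Omega>. z \<in> Bad f}))"
    by (simp only: of_nat_sum)
  also have "\<dots> \<le> (\<Sum>z\<in>W. 2 * e * n ^ l)" by (intro sum_mono bad_z)
  also have "\<dots> = real (card W) * (2 * e * n ^ l)" by simp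
  also have "\<dots> \<le> (K ^ 3 * n) * (2 * e * n ^ l)"
    using cW n0 by (intro mult_right_mono) (auto simp: e_def)
  finally have total: "(\<Sum>f\<in>\<Omega>. real (card (Bad f))) \<le> (K ^ 3 * n) * (2 * e * n ^ l)" .
  \<comment> \<open>By Markov's inequality at least half of all tuples are in \<open>F\<close>. The
    factor \<open>44\<close> in the hypothesis on \<open>l\<close> is the \<open>2\<close> of the
    two-sided tail, the \<open>11\<close> of this threshold and the \<open>2\<close> of the
    half.\<close>
  define F where "F = {f \<in> \<Omega>. real (card (Bad f)) \<le> n / 11}"
  have "real (card (\<Omega> - F)) * (n / 11) = (\<Sum>f\<in>\<Omega> - F. n / 11)" by simp
  also have "\<dots> \<le> (\<Sum>f\<in>\<Omega> - F. real (card (Bad f)))" by (intro sum_mono) (auto simp: F_def)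
  also have "\<dots> \<le> (\<Sum>f\<in>\<Omega>. real (card (Bad f)))" using f\<Omega> by (intro sum_mono2) auto
  also have "\<dots> \<le> (K ^ 3 * n) * (2 * e * n ^ l)" by (rule total)
  also have "\<dots> = (44 * K ^ 3 * e) * (n ^ l / 2) * (n / 11)" by simp
  finally have "real (card (\<Omega> - F)) \<le> (44 * K ^ 3 * e) * (n ^ l / 2)"
    using n0 by (subst (asm) mult_le_cancel_right_pos) auto
  also have "\<dots> \<le> 1 * (n ^ l / 2)" using l n0 by (intro mult_right_mono) (auto simp: e_def)
  finally have "real (card (\<Omega> - F)) \<le> n ^ l / 2" by simp
  moreover have "card (\<Omega> - F) = card \<Omega> - card F" using f\<Omega> by (intro card_Diff_subset) (auto simp: F_def)
  moreover have "card F \<le> card \<Omega>" using f\<Omega> by (intro card_mono) (auto simp: F_def)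
  ultimately have cF: "n ^ l / 2 \<le> real (card F)" using f\<Omega> by linarith
  have fF: "finite F" using f\<Omega> by (simp add: F_def)
  \<comment> \<open>\<open>\<Phi>\<close> sends the \<open>|F| |A|\<close> pairs into at most
    \<open>(K n)^l\<close> tuples over \<open>S\<close>, so some fibre has at least
    \<open>n / (2 K^l)\<close> pairs. For fixed \<open>y\<close> the shift is injective, hence a
    fibre contains as many different \<open>y\<close>.\<close>
  define \<Phi> where "\<Phi> = (\<lambda>(f, y). restrict (\<lambda>i. f i \<otimes> y) {..<l})"
  have "\<Phi> \<in> F \<times> A \<rightarrow> ({..<l} \<rightarrow>\<^sub>E S)"
    by (auto simp: \<Phi>_def F_def \<Omega>_def S_def PiE_iff intro!: set_multI split: if_splits)
  moreover have "({..<l} \<rightarrow>\<^sub>E S) \<noteq> {}" using A by (auto simp: PiE_eq_empty_iff S_def set_mult_def)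
  ultimately obtain c where c: "card (F \<times> A) \<le> card (\<Phi> -` {c} \<inter> (F \<times> A)) * card ({..<l} \<rightarrow>\<^sub>E S)"
    using pigeonhole_card[of \<Phi> "F \<times> A" "{..<l} \<rightarrow>\<^sub>E S"] fF A S by (auto simp: finite_PiE)
  define T where "T = {y \<in> A. \<exists>f\<in>F. \<Phi> (f, y) = c}"
  have TA: "T \<subseteq> A" and fT: "finite T" and Tc: "T \<subseteq> carrier G" using A by (auto simp: T_def)
  have "card (\<Phi> -` {c} \<inter> (F \<times> A)) \<le> card T"
  proof (rule card_inj_on_le[OF _ _ fT])
    show "inj_on snd (\<Phi> -` {c} \<inter> (F \<times> A))"
    proof (rule inj_onI)
      fix p q assume pq: "p \<in> \<Phi> -` {c} \<inter> (F \<times> A)" "q \<in> \<Phi> -` {c} \<inter> (F \<times> A)" "snd p = snd q"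
      obtain f h y where e: "p = (f, y)" "q = (h, y)" using pq by (cases p, cases q) auto
      have "f = h"
      proof (rule PiE_ext)
        show "f \<in> {..<l} \<rightarrow>\<^sub>E A" "h \<in> {..<l} \<rightarrow>\<^sub>E A" using pq e by (auto simp: F_def \<Omega>_def)
        fix i assume i: "i \<in> {..<l}"
        then have "f i \<in> A" "h i \<in> A" using pq e by (auto simp: F_def \<Omega>_def)
        then have cc: "f i \<in> carrier G" "h i \<in> carrier G" "y \<in> carrier G" using A pq e by auto
        have "\<Phi> (f, y) i = \<Phi> (h, y) i" using pq e by auto
        then show "f i = h i" using i cc by (simp add: \<Phi>_def right_cancel)
      qed
      then show "p = q" using e by simp
    qed
  qed (auto simp: T_def)
  then have "card F * card A \<le> card T * card S ^ l"
    using c by (simp add: card_cartesian_product card_PiE) (meson le_trans mult_le_mono1)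
  then have "real (card F) * n \<le> real (card T) * real (card S) ^ l"
    unfolding n_def by (metis of_nat_le_iff of_nat_mult of_nat_power)
  also have "\<dots> \<le> real (card T) * (K * n) ^ l"
    using K by (intro mult_left_mono power_mono) (auto simp: S_def n_def)
  finally have "n ^ l / 2 * n \<le> real (card T) * (K * n) ^ l"
    using mult_right_mono[OF cF, of n] n0 by linarith
  then have "n ^ l * n \<le> n ^ l * (2 * K ^ l * real (card T))"
    by (simp add: power_mult_distrib algebra_simps)
  then have nT: "n \<le> 2 * K ^ l * real (card T)" using n0 by (subst (asm) mult_le_cancel_left_pos) auto
  then have Tne: "T \<noteq> {}" using n0 by auto
  \<comment> \<open>Almost invariance in a form that composes: both the permitted loss and the
    number of exceptional points are linear in \<open>r\<close>. It is one-sided, as a lower bound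
    on \<open>g (z \<otimes> t)\<close> is what is wanted.\<close>
  define nice where "nice r t \<longleftrightarrow> real (card {z \<in> carrier G. g (z \<otimes> t) < g z - 2 * real r / 11}) \<le> 2 * real r * n / 11" for r t
  have nice_fin: "finite {z \<in> carrier G. g (z \<otimes> t) < g z - 2 * real r / 11}" for r t
  proof (rule finite_subset[OF _ W(2)], clarify)
    fix z assume z: "z \<in> carrier G" "g (z \<otimes> t) < g z - 2 * real r / 11"
    have "0 \<le> 2 * real r / 11" by simp
    then have "g z \<noteq> 0" using z g0[of "z \<otimes> t"] by linarith
    then show "z \<in> W" using gW z by blast
  qed
  have nice1: "nice 1 t" if t: "t \<in> diffset T" for t
  proof -
    obtain y' y where y: "y' \<in> T" "y \<in> T" "t = y' \<otimes> inv y" using t by (auto elim!: set_multE)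
    obtain f f' where f: "f \<in> F" "\<Phi> (f, y) = c" "f' \<in> F" "\<Phi> (f', y') = c"
      using y by (auto simp: T_def)
    have yc: "y \<in> carrier G" "y' \<in> carrier G" "t \<in> carrier G" using y Tc by auto
    have fc: "f i \<in> carrier G" "f' i \<in> carrier G" if "i < l" for i
      using f that A by (auto simp: F_def \<Omega>_def)
    \<comment> \<open>Both shifts give the tuple \<open>c\<close>, so the sample of \<open>f\<close>
      at \<open>z\<close> is the sample of \<open>f'\<close> at \<open>z \<otimes> t\<close>. Thus
      \<open>g z\<close> and \<open>g (z \<otimes> t)\<close> are both close to one and the same
      average.\<close>
    have ff: "z \<otimes> f i = (z \<otimes> t) \<otimes> f' i" if i: "i < l" and z: "z \<in> carrier G" for i z
    proof -
      have "\<Phi> (f, y) i = \<Phi> (f', y') i" using f by simp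
      then have e: "f i \<otimes> y = f' i \<otimes> y'" using i by (simp add: \<Phi>_def)
      have "f i = (f i \<otimes> y) \<otimes> inv y" using fc[OF i] yc by (simp add: m_assoc)
      also have "\<dots> = t \<otimes> f' i" unfolding e y(3) using fc[OF i] yc by (simp only: m_closed inv_closed m_ac)
      finally show ?thesis using fc[OF i] yc z by (simp only: m_closed m_assoc)
    qed
    have sub: "{z \<in> carrier G. g (z \<otimes> t) < g z - 2 * real 1 / 11} \<subseteq> Bad f \<union> (\<lambda>w. w \<otimes> inv t) ` Bad f'"
    proof (clarify)
      fix z assume z: "z \<in> carrier G" "g (z \<otimes> t) < g z - 2 * real 1 / 11"
        "z \<notin> (\<lambda>w. w \<otimes> inv t) ` Bad f'"
      have zt: "z \<otimes> t \<in> carrier G" using z yc by simp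
      have "z = (z \<otimes> t) \<otimes> inv t" using z yc by (simp add: m_assoc)
      then have "z \<otimes> t \<notin> Bad f'" using z(3) by (metis image_eqI)
      then have b': "\<bar>\<Sum>i<l. u (z \<otimes> t) (f' i)\<bar> < \<epsilon> * real l" using zt by (simp add: Bad_def)
      show "z \<in> Bad f"
      proof (rule ccontr)
        assume "z \<notin> Bad f"
        then have b: "\<bar>\<Sum>i<l. u z (f i)\<bar> < \<epsilon> * real l" using z by (simp add: Bad_def)
        define q where "q = (\<Sum>i<l. (of_bool (z \<otimes> f i \<in> S) :: real))"
        have q': "q = (\<Sum>i<l. of_bool ((z \<otimes> t) \<otimes> f' i \<in> S))"
          unfolding q_def using ff z by (intro sum.cong) auto
        have "(\<Sum>i<l. u z (f i)) = q - real l * g z" by (simp add: u_def sum_subtractf q_def)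
        moreover have "(\<Sum>i<l. u (z \<otimes> t) (f' i)) = q - real l * g (z \<otimes> t)"
          by (simp add: u_def sum_subtractf q')
        ultimately have "real l * g z - real l * g (z \<otimes> t) < 2 * (\<epsilon> * real l)"
          using b b' by linarith
        then have "real l * (g z - g (z \<otimes> t)) < real l * (2 * \<epsilon>)"
          by (simp add: algebra_simps)
        then have "g z - g (z \<otimes> t) < 2 * \<epsilon>" using l0 by simp
        then show False using z(2) by (simp add: \<epsilon>_def)
      qed
    qed
    have fB: "finite (Bad f)" "finite (Bad f')"
      using BadW f W(2) by (auto simp: F_def intro: finite_subset)
    have "card {z \<in> carrier G. g (z \<otimes> t) < g z - 2 * real 1 / 11} \<le> card (Bad f \<union> (\<lambda>w. w \<otimes> inv t) ` Bad f')"
      using fB by (intro card_mono sub) auto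
    also have "\<dots> \<le> card (Bad f) + card ((\<lambda>w. w \<otimes> inv t) ` Bad f')" by (rule card_Un_le)
    also have "\<dots> \<le> card (Bad f) + card (Bad f')" using fB by (simp add: card_image_le)
    finally show ?thesis using f unfolding nice_def F_def by auto
  qed
  have Dc: "spow (diffset T) r \<subseteq> carrier G" for r using Tc by simp
  have nice: "nice r t" if "t \<in> spow (diffset T) r" for r t
    using that
  proof (induction r arbitrary: t)
    case 0
    then have "{z \<in> carrier G. g (z \<otimes> t) < g z - 2 * real 0 / 11} = {}" by auto
    then show ?case unfolding nice_def by (simp only: card.empty mult_zero_right mult_zero_left of_nat_0 div_0)
  next
    case (Suc r)
    from Suc.prems have "t \<in> spow (diffset T) r <#> diffset T" by simp
    then obtain p s where ps: "p \<in> spow (diffset T) r" "s \<in> diffset T" "t = p \<otimes> s"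
      by (rule set_multE)
    have "diffset T \<subseteq> carrier G" using Tc by simp
    then have c: "p \<in> carrier G" "s \<in> carrier G" using ps Dc[of r] by blast+
    let ?E = "\<lambda>r t. {z \<in> carrier G. g (z \<otimes> t) < g z - 2 * real r / 11}"
    \<comment> \<open>A point losing too much under \<open>p \<otimes> s\<close> either loses too
      much under \<open>p\<close>, or its translate by \<open>p\<close> loses too much under
      \<open>s\<close>.\<close>
    have sub: "?E (Suc r) t \<subseteq> ?E r p \<union> (\<lambda>w. w \<otimes> inv p) ` ?E 1 s"
    proof clarify
      fix z assume z: "z \<in> carrier G" "g (z \<otimes> t) < g z - 2 * real (Suc r) / 11"
        "z \<notin> (\<lambda>w. w \<otimes> inv p) ` ?E 1 s"
      have "z = (z \<otimes> p) \<otimes> inv p" using z c by (simp add: m_assoc)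
      then have "z \<otimes> p \<notin> ?E 1 s" using z(3) by (metis (no_types, lifting) image_eqI)
      then have "g (z \<otimes> p) - 2 / 11 \<le> g ((z \<otimes> p) \<otimes> s)" using z(1) c by simp
      also have "(z \<otimes> p) \<otimes> s = z \<otimes> t" using z(1) c ps by (simp add: m_assoc)
      finally show "g (z \<otimes> p) < g z - 2 * real r / 11" using z(2) by (simp add: field_simps)
    qed
    have "card (?E (Suc r) t) \<le> card (?E r p \<union> (\<lambda>w. w \<otimes> inv p) ` ?E 1 s)"
      using nice_fin by (intro card_mono sub finite_UnI finite_imageI)
    also have "\<dots> \<le> card (?E r p) + card ((\<lambda>w. w \<otimes> inv p) ` ?E 1 s)" by (rule card_Un_le)
    also have "\<dots> \<le> card (?E r p) + card (?E 1 s)"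
      using nice_fin[of s 1] by (intro add_left_mono card_image_le)
    finally have "real (card (?E (Suc r) t)) \<le> real (card (?E r p)) + real (card (?E 1 s))" by linarith
    also have "\<dots> \<le> 2 * real r * n / 11 + 2 * real 1 * n / 11"
      using Suc.IH[OF ps(1)] nice1[OF ps(2)] unfolding nice_def by (rule add_mono)
    also have "\<dots> = 2 * real (Suc r) * n / 11" by (simp add: field_simps)
    finally show ?case unfolding nice_def .
  qed
  show thesis
  proof (rule that[OF TA Tne])
    show "real (card A) \<le> 2 * K ^ l * real (card T)" using nT by (simp add: n_def)
    show "spow (diffset T) 5 \<subseteq> diffset (spow A 2)"
    proof
      fix t assume t: "t \<in> spow (diffset T) 5"
      have tc: "t \<in> carrier G" using t Dc by blast
      let ?E = "{z \<in> carrier G. g (z \<otimes> t) < g z - 2 * real 5 / 11}"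
      \<comment> \<open>At most \<open>10n / 11 < n\<close> points are exceptional, so some
        \<open>z \<in> A\<close>, where \<open>g z = 1\<close>, is not; there
        \<open>g (z \<otimes> t) \<ge> 1 / 11\<close>.\<close>
      have "real (card ?E) < real (card A)" using nice[OF t] n0 by (simp add: nice_def n_def)
      then have "\<not> A \<subseteq> ?E" using card_mono[OF nice_fin, of A t 5] by linarith
      then obtain z where z: "z \<in> A" "z \<notin> ?E" by blast
      then have zc: "z \<in> carrier G" using A by auto
      then have "g (z \<otimes> t) \<ge> 1 - 10 / 11" using z gA[of z] by simp
      then have "g (z \<otimes> t) \<noteq> 0" by simp
      then obtain a where a: "a \<in> A" "(z \<otimes> t) \<otimes> a \<in> S"
        unfolding g_def by (metis (mono_tags, lifting) card.empty div_0 empty_Collect_eq of_nat_0)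
      have ac: "a \<in> carrier G" using a A by auto
      have sA: "spow A 2 = A <#> A" using A by (simp add: numeral_2_eq_2)
      have "((z \<otimes> t) \<otimes> a) \<otimes> inv (z \<otimes> a) = (z \<otimes> inv z) \<otimes> ((a \<otimes> inv a) \<otimes> t)"
        using zc tc ac by (simp only: inv_mult m_closed inv_closed m_ac)
      then have "t = ((z \<otimes> t) \<otimes> a) \<otimes> inv (z \<otimes> a)" using zc tc ac by simp
      moreover have "z \<otimes> a \<in> spow A 2" using z a by (simp add: sA set_multI)
      moreover have "(z \<otimes> t) \<otimes> a \<in> spow A 2" using a by (simp add: sA S_def)
      ultimately show "t \<in> diffset (spow A 2)" by (metis imageI set_multI)
    qed
  qed
qed

subsection \<open>The bounds and their transfer to arbitrary groups\<close>

text \<open>Taking logarithms in the covering bound leaves \<open>4 log K + log |A|\<close> from the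
  size of \<open>W\<close> and \<open>|F| log Q\<close> from the box. The constant is
  \<open>327004 = 13080 \<cdot> 25 + 4\<close>, from the bounds on \<open>|F|\<close> and
  \<open>log Q\<close> and from the term \<open>4 log K\<close>.\<close>

lemma dissociated_bound_large_doubling:
  assumes L: "dissociated G L" "L \<subseteq> A" and A: "finite A" "A \<subseteq> carrier G" "4 \<le> card A"
    and K: "2 \<le> K" "real (card (A <#> A)) \<le> K * real (card A)"
  shows "real (card L) \<le> log 2 (card A) + 327004 * K * log 2 K ^ 3 * log 2 (log 2 (card A))"
proof (cases "L = {}")
  case True
  have "2 \<le> log 2 (card A)" using A by (simp add: le_log_iff powr_numeral)
  then have "0 \<le> log 2 (log 2 (card A))" by simp
  then show ?thesis using True K \<open>2 \<le> log 2 (card A)\<close> by simp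
next
  case False
  define m where "m = real (card L)"
  define a where "a = log 2 (card A)"
  define b where "b = log 2 a"
  define k where "k = log 2 K"
  \<comment> \<open>\<open>4356 = 9 \<cdot> 484\<close>: almost periodicity asks for
    \<open>l / 484 \<ge> ln (44 K^3)\<close>, which is at most \<open>9 ln K\<close> because
    \<open>44 \<le> K^6\<close> for \<open>K \<ge> 2\<close>.\<close>
  define l where "l = nat \<lceil>4356 * k\<rceil>"
  define M where "M = nat \<lceil>2 * K\<rceil>"
  have fL: "finite L" using L by (auto simp: dissociated_def)
  have m1: "m \<ge> 1" using False fL by (simp add: m_def Suc_le_eq card_gt_0_iff)
  have a2: "a \<ge> 2" using A by (simp add: a_def le_log_iff powr_numeral)
  have b1: "b \<ge> 1" using a2 by (simp add: b_def)
  have k1: "k \<ge> 1" using K by (simp add: k_def)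
  have kk: "k \<le> k\<^sup>2" "k \<le> k ^ 3" using k1 by (auto intro: self_le_power)
  have l: "4356 * k \<le> real l" "real l \<le> 4357 * k" unfolding l_def using k1 by linarith+
  have M: "2 * K \<le> real M" "real M \<le> 3 * K" unfolding M_def using K by linarith+
  have Ane: "A \<noteq> {}" using A by auto
  have "44 * K ^ 3 * exp (- real l / 484) \<le> 1"
  proof -
    have "ln K \<le> k" using K by (simp add: k_def log_def field_simps ln_2_less_1 less_imp_le mult_left_le)
    then have "9 * ln K \<le> real l / 484" using l by simp
    have "(64::real) = 2 ^ 6" by simp
    also have "(2::real) ^ 6 \<le> K ^ 6" using K by (intro power_mono) auto
    finally have "44 * K ^ 3 \<le> K ^ 6 * K ^ 3" using K by (intro mult_right_mono) auto
    also have "\<dots> = K ^ 9" by (simp flip: power_add)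
    also have "K ^ 9 = exp (9 * ln K)" using K exp_of_nat_mult[of 9 "ln K"] by simp
    also have "\<dots> \<le> exp (real l / 484)" using \<open>9 * ln K \<le> real l / 484\<close> by simp
    finally have "44 * K ^ 3 * exp (- real l / 484) \<le> exp (real l / 484) * exp (- real l / 484)"
      by (intro mult_right_mono) auto
    then show ?thesis by (simp flip: exp_add)
  qed
  then obtain T where T: "T \<subseteq> A" "T \<noteq> {}" "real (card A) \<le> 2 * K ^ l * real (card T)"
    "spow (diffset T) 5 \<subseteq> diffset (spow A 2)"
    using croot_sisask[OF A(1,2) Ane _ K(2)] K by auto
  obtain j F where j: "2 ^ j \<le> K * (2 * K ^ l)" and F: "finite F" "F \<subseteq> carrier G" "card F \<le> M * (j + 1)"
    "A \<subseteq> diffset T <#> spow (symm F) (2 * j + 1)"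
    using chang_covering[OF A(1,2) T(1,2) _ K(2) M(1) T(3)] K by auto
  define N where "N = 2 * j + 1"
  \<comment> \<open>The covering loss is \<open>R = 2 K^l\<close> with \<open>l\<close> of order
    \<open>log K\<close>, so the number of rounds is of order \<open>(log K)^2\<close>.\<close>
  have jk: "real (j + 1) \<le> 4360 * k\<^sup>2"
  proof -
    have "real j = log 2 (2 ^ j)" by simp
    also have "\<dots> \<le> log 2 (2 * K ^ Suc l)" using j K by (subst log_le_cancel_iff) (auto simp: mult_ac)
    also have "\<dots> = 1 + real (Suc l) * k"
      unfolding k_def using K by (subst log_mult) (simp_all add: log_nat_power del: power_Suc)
    also have "real (Suc l) * k \<le> (4358 * k) * k" using l k1 by (intro mult_right_mono) auto
    finally have "real j \<le> 1 + 4358 * k\<^sup>2" by (simp add: power2_eq_square)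
    then show ?thesis using kk k1 by simp
  qed
  have cF: "real (card F) \<le> 13080 * K * k\<^sup>2"
  proof -
    have "real (card F) \<le> real M * real (j + 1)" using F by (metis of_nat_le_iff of_nat_mult)
    also have "\<dots> \<le> (3 * K) * (4360 * k\<^sup>2)" using M jk K by (intro mult_mono) auto
    finally show ?thesis by simp
  qed
  have N: "real N \<le> 8720 * k\<^sup>2" "1 \<le> real N" using jk by (auto simp: N_def)
  have m_first: "m \<le> 4 * K * a"
    using dissociated_bound[OF L A(1,2) _ _ K(2)] A K by (simp add: m_def a_def)
  define Q where "Q = 2 * (card L * (5 * N)) + 1"
  have Q1: "1 \<le> real Q" by (simp add: Q_def)
  have logQ: "log 2 Q \<le> 25 * k * b"
  proof -
    have "1 \<le> m * real N" using m1 N mult_mono[of 1 m 1 "real N"] by simp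
    moreover have "real Q = 10 * (m * real N) + 1" by (simp add: Q_def m_def)
    ultimately have "real Q \<le> 11 * (m * real N)" by linarith
    also have "\<dots> \<le> 11 * ((4 * K * a) * (8720 * k\<^sup>2))"
      using m_first N m1 by (intro mult_left_mono mult_mono) auto
    also have "\<dots> = 383680 * K * a * k\<^sup>2" by simp
    also have "\<dots> \<le> 2 ^ 19 * K * a * k\<^sup>2" using K a2 by (intro mult_right_mono) auto
    finally have "log 2 Q \<le> log 2 (2 ^ 19 * K * a * k\<^sup>2)"
      using Q1 by (intro log_mono) auto
    also have "\<dots> = 19 + k + b + 2 * log 2 k"
    proof -
      have "log 2 (524288::real) = 19" using log_pow_cancel[of "2::real" 19] by simp
      moreover have "log 2 (k\<^sup>2) = 2 * log 2 k" using k1 by (simp add: log_nat_power)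
      moreover have "0 < K" "0 < a" "0 < k" using K a2 k1 by auto
      ultimately show ?thesis by (simp add: log_mult b_def flip: k_def)
    qed
    also have "log 2 k \<le> 2 * k"
    proof -
      have "log 2 k \<le> (k - 1) / ln 2"
        unfolding log_def using k1 by (intro divide_right_mono ln_le_minus_one) auto
      moreover have "ln 2 \<ge> (1 / 2 :: real)"
        using ln_le_minus_one[of "1 / 2 :: real"] by (simp add: ln_div)
      then have "(k - 1) / ln 2 \<le> (k - 1) / (1 / 2)"
        using k1 by (intro divide_left_mono) auto
      ultimately show ?thesis by simp
    qed
    finally have "log 2 Q \<le> 19 + 5 * k + b" by simp
    \<comment> \<open>The product absorbs the sum because \<open>k \<ge> 1\<close> and
      \<open>b \<ge> 1\<close>, which come from \<open>K \<ge> 2\<close> and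
      \<open>|A| \<ge> 4\<close>.\<close>
    also have "\<dots> \<le> 24 * (k * b) + k * b"
    proof -
      have "k \<le> k * b" "b \<le> k * b" using k1 b1 by (auto simp: mult_le_cancel_left1 mult_le_cancel_right1)
      then show ?thesis using k1 by linarith
    qed
    finally show ?thesis by (simp add: mult_ac)
  qed
  have "2 ^ card L \<le> card (diffset (spow A 2)) * Q ^ card F"
    unfolding Q_def N_def by (rule dissociated_bound_covering[OF L A(1,2) Ane T(1,2,4) F(1,2,4)])
  then have "2 ^ card L \<le> real (card (diffset (spow A 2))) * real Q ^ card F"
    by (metis of_nat_le_iff of_nat_mult of_nat_numeral of_nat_power)
  also have "\<dots> \<le> (K ^ 4 * real (card A)) * real Q ^ card F"
    using card_sum_diff_le[OF A(1,2) Ane K(2), of 2 2] by (intro mult_right_mono) auto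
  finally have "log 2 (2 ^ card L) \<le> log 2 (K ^ 4 * real (card A) * real Q ^ card F)"
    by (intro log_mono) auto
  also have "\<dots> = 4 * k + a + real (card F) * log 2 Q"
    using K A Q1 Ane by (simp add: log_mult log_nat_power k_def a_def)
  finally have "m \<le> 4 * k + a + real (card F) * log 2 Q" by (simp add: m_def)
  also have "real (card F) * log 2 Q \<le> (13080 * K * k\<^sup>2) * (25 * k * b)"
    using cF logQ K Q1 by (intro mult_mono) auto
  also have "4 * k \<le> 4 * (K * k ^ 3 * b)"
  proof -
    have "1 * k \<le> K * k ^ 3" using K kk k1 by (intro mult_mono) auto
    then have "(1 * k) * 1 \<le> (K * k ^ 3) * b" using K kk b1 k1 by (intro mult_mono) auto
    then show ?thesis by simp
  qed
  finally show ?thesis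
    by (simp add: m_def a_def b_def k_def power2_eq_square power3_eq_cube algebra_simps)
qed

section \<open>The dimension as an attained maximum\<close>

lemma finite_additive_dim_set:
  assumes "finite A"
  shows "finite {card S |S. S \<subseteq> A \<and> dissociated G S}"
proof -
  have "{card S |S. S \<subseteq> A \<and> dissociated G S} = card ` {S. S \<subseteq> A \<and> dissociated G S}" by auto
  then show ?thesis using assms by simp
qed

lemma additive_dim_attained:
  assumes "finite A"
  obtains L where "L \<subseteq> A" "dissociated G L" "card L = additive_dim G A"
proof -
  have "dissociated G {}" by (simp add: dissociated_def)
  then have "{card S |S. S \<subseteq> A \<and> dissociated G S} \<noteq> {}" by blast
  then have "additive_dim G A \<in> {card S |S. S \<subseteq> A \<and> dissociated G S}"
    unfolding additive_dim_def using finite_additive_dim_set[OF assms] by (rule Max_in[rotated])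
  then show thesis using that by auto
qed

lemma card_le_additive_dim:
  "finite A \<Longrightarrow> L \<subseteq> A \<Longrightarrow> dissociated G L \<Longrightarrow> card L \<le> additive_dim G A"
  unfolding additive_dim_def by (intro Max_ge finite_additive_dim_set) auto

end

section \<open>One constant for all groups\<close>

text \<open>For turning \<open>2^d \<le> (d + 1) (2 |A|)\<close> into
  \<open>2^d \<le> 16 |A|^2\<close>: after squaring, \<open>(d + 1)^2\<close> is traded for one
  factor \<open>2^d\<close>.\<close>

lemma Suc_square_le: "(n + 1)\<^sup>2 \<le> 4 * 2 ^ (n::nat)"
proof (induction n rule: less_induct)
  case (less n)
  show ?case
  proof (cases "n \<le> 2")
    case True
    then have "n = 0 \<or> n = 1 \<or> n = 2" by auto
    then show ?thesis by (auto simp: power2_eq_square)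
  next
    case False
    then obtain p where p: "n = Suc p" "p \<ge> 2" by (cases n) auto
    have "(n + 1)\<^sup>2 = p * p + 4 * p + 4" by (simp add: p power2_eq_square)
    also have "\<dots> \<le> 2 * (p + 1)\<^sup>2" using mult_le_mono[OF p(2) p(2)] by (simp add: power2_eq_square)
    also have "\<dots> \<le> 2 * (4 * 2 ^ p)" using less[of p] p by simp
    finally show ?thesis by (simp add: p)
  qed
qed

text \<open>The cases are split by the true doubling of \<open>A\<close>, as \<open>K\<close> is
  only an upper bound for it. If the doubling is at least \<open>3 / 2\<close>, then so is
  \<open>K\<close>, and the estimate for large doubling is applied with \<open>2K\<close>.\<close>

lemma dim_bounds_uniform:
  assumes "comm_group G"
  shows "dim_bounds (10 ^ 9) G"
  unfolding dim_bounds_def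
proof (intro allI impI conjI)
  interpret comm_group G by fact
  fix A and K :: real
  assume A: "A \<subseteq> carrier G" "finite A" "2 \<le> card A"
    and K: "1 \<le> K" "real (card (A <#>\<^bsub>G\<^esub> A)) \<le> K * real (card A)"
  obtain L where L: "L \<subseteq> A" "dissociated G L" "card L = additive_dim G A"
    using additive_dim_attained[OF A(2)] .
  define a where "a = log 2 (real (card A))"
  define k where "k = log 2 K"
  have a1: "a \<ge> 1" using A by (simp add: a_def)
  have k0: "k \<ge> 0" using K by (simp add: k_def)
  have "real (card L) \<le> 4 * (K * a)"
    using dissociated_bound[OF L(2,1) A(2,1,3) K] by (simp add: a_def)
  also have "\<dots> \<le> 10 ^ 9 * (K * a)" using K a1 by (intro mult_right_mono) auto
  finally show "real (additive_dim G A) \<le> 10 ^ 9 * (K * log 2 (real (card A)))"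
    by (simp add: a_def L)
  have b0: "log 2 a \<ge> 0" using a1 by simp
  have rest0: "K * k ^ 8 * log 2 a \<ge> 0" using K k0 b0 by simp
  have "real (card L) \<le> 10 ^ 9 * (a + K * k ^ 8 * log 2 a)"
  proof (cases "card A < 4")
    \<comment> \<open>For \<open>|A| = 2\<close> the term \<open>log log |A|\<close> is zero, so
      \<open>log |A|\<close> alone has to bound the at most three elements of
      \<open>L\<close>.\<close>
    case True
    have "card L \<le> card A" using A L by (intro card_mono) auto
    then have "real (card L) \<le> 3 * a" using True a1 by simp
    then show ?thesis using rest0 a1 by simp
  next
    case False
    show ?thesis
    proof (cases "2 * card (A <#>\<^bsub>G\<^esub> A) < 3 * card A")
      case True
      have Ane: "A \<noteq> {}" using A by auto
      have "2 ^ card L \<le> (card L + 1) * (2 * card A)"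
        using A by (intro dissociated_bound_small_doubling[OF L(2,1) A(2,1) _ True]) auto
      then have "(2 ^ card L)\<^sup>2 \<le> ((card L + 1) * (2 * card A))\<^sup>2" by (rule power_mono) simp
      also have "\<dots> = (card L + 1)\<^sup>2 * (2 * card A)\<^sup>2" by (rule power_mult_distrib)
      also have "\<dots> \<le> (4 * 2 ^ card L) * (2 * card A)\<^sup>2" by (intro mult_right_mono Suc_square_le) simp
      finally have "2 ^ card L \<le> 16 * (card A)\<^sup>2" by (simp add: power2_eq_square)
      then have "real (2 ^ card L) \<le> real (16 * (card A)\<^sup>2)" by (simp only: of_nat_le_iff)
      then have "2 ^ card L \<le> 2 ^ 4 * (real (card A))\<^sup>2" by simp
      then have "log 2 (2 ^ card L) \<le> log 2 (2 ^ 4 * (real (card A))\<^sup>2)"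
        by (intro log_mono) auto
      also have "\<dots> = log 2 (2 ^ 4) + log 2 ((real (card A))\<^sup>2)"
        using A Ane by (subst log_mult) auto
      also have "\<dots> = 4 + 2 * a"
        using A log_pow_cancel[of "2::real" 4] by (simp add: log_nat_power a_def)
      finally have "real (card L) \<le> 4 + 2 * a" by simp
      then show ?thesis using rest0 a1 by simp
    next
      case big: False
      then have "3 * card A \<le> 2 * card (A <#>\<^bsub>G\<^esub> A)" by simp
      then have "3 * real (card A) \<le> (2 * K) * real (card A)" using K by linarith
      then have K32: "3 / 2 \<le> K" using A by (subst (asm) mult_le_cancel_right_pos) auto
      have k12: "1 \<le> 2 * k"
      proof -
        have "log 2 (2 powr (1 / 2)) \<le> log 2 K"
        proof (rule log_mono)
          have "sqrt 2 \<le> 3 / 2" by (rule real_le_lsqrt) (auto simp: power2_eq_square)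
          then show "2 powr (1 / 2) \<le> K" using K32 by (simp add: powr_half_sqrt)
        qed auto
        then show ?thesis by (simp add: k_def)
      qed
      have "real (card (A <#>\<^bsub>G\<^esub> A)) \<le> (2 * K) * real (card A)" using K by simp
      then have "real (card L) \<le> a + 327004 * (2 * K) * log 2 (2 * K) ^ 3 * log 2 a"
        using dissociated_bound_large_doubling[OF L(2,1) A(2,1), of "2 * K"] False K
        by (simp add: a_def)
      also have "log 2 (2 * K) = 1 + k" using K by (simp add: log_mult k_def)
      \<comment> \<open>From \<open>k \<ge> 1 / 2\<close> one has \<open>1 + k \<le> 3k\<close> and
        \<open>1 \<le> (2k)^5\<close>, which lifts the third power to the eighth at the cost of
        \<open>27 \<cdot> 32\<close>. The final constant
        \<open>327004 \<cdot> 2 \<cdot> 27 \<cdot> 32 = 565062912\<close> is below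
        \<open>10^9\<close>.\<close>
      also have "327004 * (2 * K) * (1 + k) ^ 3 * log 2 a \<le> 327004 * (2 * K) * (27 * (32 * k ^ 8)) * log 2 a"
      proof (intro mult_right_mono mult_left_mono)
        have "(1 + k) ^ 3 \<le> (3 * k) ^ 3" using k12 by (intro power_mono) auto
        then have "(1 + k) ^ 3 \<le> 27 * k ^ 3" by (simp add: power_mult_distrib)
        moreover have "k ^ 3 * 1 \<le> k ^ 3 * (2 * k) ^ 5"
          using k12 k0 by (intro mult_left_mono one_le_power) auto
        moreover have "k ^ 3 * (2 * k) ^ 5 = 32 * k ^ 8"
          using power_add[of k 3 5] by (simp add: power_mult_distrib)
        ultimately show "(1 + k) ^ 3 \<le> 27 * (32 * k ^ 8)" by linarith
      qed (use b0 K in auto)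
      also have "\<dots> = 565062912 * (K * k ^ 8 * log 2 a)" by simp
      finally show ?thesis using rest0 a1 by simp
    qed
  qed
  then show "real (additive_dim G A) \<le>
      10 ^ 9 * (log 2 (real (card A)) + K * (log 2 K) ^ 8 * log 2 (log 2 (real (card A))))"
    by (simp add: a_def k_def L)
qed

text \<open>The subgroup generated by a finite set is countable, so it can be copied onto natural numbers.\<close>

lemma transfer_to_nat:
  fixes G :: "('a, 'b) monoid_scheme" (structure)
  assumes "comm_group G" and A: "A \<subseteq> carrier G" "finite A"
  obtains H :: "nat monoid" and B where "comm_group H" "B \<subseteq> carrier H" "finite B"
    "card B = card A" "card (B <#>\<^bsub>H\<^esub> B) = card (A <#>\<^bsub>G\<^esub> A)" "additive_dim G A \<le> additive_dim H B"
proof -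
  interpret comm_group G by fact
  define S where "S = symm A"
  have S: "S \<subseteq> carrier G" "finite S" "m_inv G ` S = S" "A \<subseteq> S"
    using A by (simp_all add: S_def) (auto simp: symm_def)
  \<comment> \<open>\<open>S\<close> contains \<open>\<one>\<close> and is closed under inverses, so
    this union is the subgroup generated by \<open>A\<close>; it is countable as a countable union
    of finite sets.\<close>
  define E where "E = (\<Union>n. spow S n)"
  define \<phi> where "\<phi> = to_nat_on E"
  have Ec: "E \<subseteq> carrier G" unfolding E_def using spow_closed[OF S(1)] by blast
  have AE: "A \<subseteq> E"
  proof -
    have "A \<subseteq> spow S (Suc 0)" using S by (simp only: spow_1)
    then show ?thesis by (auto simp: E_def simp del: spow.simps)
  qed
  have E: "subgroup E G"
  proof (rule subgroupI[OF Ec])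
    have "\<one> \<in> spow S 0" by simp
    then show "E \<noteq> {}" unfolding E_def by blast
  next
    fix x assume "x \<in> E"
    then obtain n where "x \<in> spow S n" by (auto simp: E_def)
    then have "inv x \<in> m_inv G ` spow S n" by blast
    then show "inv x \<in> E" using S by (auto simp: E_def inv_spow)
  next
    fix x y assume "x \<in> E" "y \<in> E"
    then obtain m n where "x \<in> spow S m" "y \<in> spow S n" by (auto simp: E_def)
    then have "x \<otimes> y \<in> spow S (m + n)" using S by (simp add: spow_add set_multI)
    then show "x \<otimes> y \<in> E" by (auto simp: E_def)
  qed
  have "countable E" unfolding E_def using S by (intro countable_UN) (simp_all add: countable_finite)
  then have inj: "inj_on \<phi> E" unfolding \<phi>_def by (rule inj_on_to_nat_on)
  define \<psi> where "\<psi> = inv_into E \<phi>"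
  have \<psi>: "\<psi> (\<phi> x) = x" if "x \<in> E" for x using inj that by (simp add: \<psi>_def)
  define H :: "nat monoid" where
    "H = \<lparr>carrier = \<phi> ` E, mult = (\<lambda>x y. \<phi> (\<psi> x \<otimes> \<psi> y)), one = \<phi> \<one>\<rparr>"
  have Hmult: "\<phi> x \<otimes>\<^bsub>H\<^esub> \<phi> y = \<phi> (x \<otimes> y)" if "x \<in> E" "y \<in> E" for x y
    using that \<psi> by (simp add: H_def)
  have Hone: "\<one>\<^bsub>H\<^esub> = \<phi> \<one>" and Hcar: "carrier H = \<phi> ` E" by (simp_all add: H_def)
  note Esub = subgroup.m_closed[OF E] subgroup.one_closed[OF E] subgroup.m_inv_closed[OF E]
  have xc: "x \<in> carrier G" if "x \<in> E" for x using Ec that by auto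
  have H: "comm_group H"
  proof (rule comm_groupI)
    fix x assume "x \<in> carrier H"
    then obtain y where "y \<in> E" "x = \<phi> y" by (auto simp: Hcar)
    then show "\<exists>y\<in>carrier H. y \<otimes>\<^bsub>H\<^esub> x = \<one>\<^bsub>H\<^esub>"
      by (intro bexI[of _ "\<phi> (inv y)"]) (auto simp: Hmult Hone Hcar Esub xc)
  qed (auto simp: Hmult Hone Hcar Esub xc m_assoc intro!: arg_cong[where f = \<phi>] m_comm)
  interpret H: comm_group H by (rule H)
  have Esubgrp: "group (G\<lparr>carrier := E\<rparr>)" by (rule subgroup.subgroup_is_group[OF E is_group])
  have "\<phi> \<in> hom (G\<lparr>carrier := E\<rparr>) H" by (auto simp: hom_def Hcar Hmult)
  then interpret h: group_hom "G\<lparr>carrier := E\<rparr>" H \<phi>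
    using Esubgrp H.is_group by (simp add: group_hom_def group_hom_axioms_def)
  have pow: "\<phi> x [^]\<^bsub>H\<^esub> (i::int) = \<phi> (x [^] i)" "x [^] i \<in> E" if "x \<in> E" for x i
    using h.hom_int_pow[of x i] int_pow_consistent[OF E that, of i] that
      group.int_pow_closed[OF Esubgrp, of x i] by simp_all
  \<comment> \<open>Membership in \<open>E\<close> is carried through the induction because
    multiplicativity of \<open>\<phi>\<close> is available only there.\<close>
  have prod: "finprod H (\<lambda>x. \<phi> (f x)) L = \<phi> (finprod G f L) \<and> finprod G f L \<in> E"
    if "finite L" "\<And>x. x \<in> L \<Longrightarrow> f x \<in> E" for f and L :: "'a set"
    using that
  proof (induction L rule: finite_induct)
    case empty
    then show ?case by (simp add: Hone Esub)
  next
    case (insert x L)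
    then have "finprod H (\<lambda>x. \<phi> (f x)) (insert x L) = \<phi> (f x) \<otimes>\<^bsub>H\<^esub> finprod H (\<lambda>x. \<phi> (f x)) L"
      by (intro H.finprod_insert) (auto simp: Hcar)
    moreover have "finprod G f (insert x L) = f x \<otimes> finprod G f L"
      using insert by (intro finprod_insert) (auto simp: xc)
    ultimately show ?case using insert by (auto simp: Hmult Esub)
  qed
  have diss: "dissociated H (\<phi> ` L)" if L: "dissociated G L" "L \<subseteq> A" for L
    unfolding dissociated_def
  proof (intro conjI allI impI)
    have LE: "L \<subseteq> E" and fL: "finite L" using L AE by (auto simp: dissociated_def)
    show "finite (\<phi> ` L)" "\<phi> ` L \<subseteq> carrier H" using LE fL by (auto simp: Hcar)
    \<comment> \<open>Coefficients on the image of \<open>L\<close> are pulled back along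
      \<open>\<phi>\<close>, and injectivity on \<open>E\<close> turns the relation in
      \<open>H\<close> into one in \<open>G\<close>.\<close>
    fix \<epsilon> :: "nat \<Rightarrow> int"
    assume e: "\<forall>x\<in>\<phi> ` L. \<epsilon> x \<in> {-1, 0, 1}" and p: "finprod H (\<lambda>x. x [^]\<^bsub>H\<^esub> \<epsilon> x) (\<phi> ` L) = \<one>\<^bsub>H\<^esub>"
    have injL: "inj_on \<phi> L" using inj LE by (rule inj_on_subset)
    have "finprod H (\<lambda>x. x [^]\<^bsub>H\<^esub> \<epsilon> x) (\<phi> ` L) = finprod H (\<lambda>x. \<phi> x [^]\<^bsub>H\<^esub> \<epsilon> (\<phi> x)) L"
      using LE by (intro H.finprod_reindex injL) (auto simp: Hcar[symmetric] intro!: H.int_pow_closed)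
    also have "\<dots> = finprod H (\<lambda>x. \<phi> (x [^] \<epsilon> (\<phi> x))) L"
      using LE pow by (intro H.finprod_cong') (auto simp: Hcar)
    also have "\<dots> = \<phi> (finprod G (\<lambda>x. x [^] \<epsilon> (\<phi> x)) L)"
      using prod[OF fL, of "\<lambda>x. x [^] \<epsilon> (\<phi> x)"] LE pow by blast
    finally have "\<phi> (finprod G (\<lambda>x. x [^] \<epsilon> (\<phi> x)) L) = \<phi> \<one>" using p Hone by simp
    then have "finprod G (\<lambda>x. x [^] \<epsilon> (\<phi> x)) L = \<one>"
      using prod[OF fL, of "\<lambda>x. x [^] \<epsilon> (\<phi> x)"] LE pow Esub(2) inj_onD[OF inj] by blast
    then have "\<forall>x\<in>L. \<epsilon> (\<phi> x) = 0" using L e by (auto simp: dissociated_def)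
    then show "\<forall>x\<in>\<phi> ` L. \<epsilon> x = 0" by blast
  qed
  have injA: "inj_on \<phi> A" using inj AE by (rule inj_on_subset)
  show thesis
  proof (rule that[of H "\<phi> ` A"])
    show "comm_group H" by (rule H)
    show "\<phi> ` A \<subseteq> carrier H" "finite (\<phi> ` A)" using AE A by (auto simp: Hcar)
    show "card (\<phi> ` A) = card A" using injA by (rule card_image)
    have "\<phi> ` A <#>\<^bsub>H\<^esub> \<phi> ` A = (\<Union>x\<in>A. \<Union>y\<in>A. {\<phi> x \<otimes>\<^bsub>H\<^esub> \<phi> y})"
      by (auto simp: set_mult_def)
    also have "\<dots> = (\<Union>x\<in>A. \<Union>y\<in>A. {\<phi> (x \<otimes> y)})"
      by (intro SUP_cong refl) (simp add: Hmult subsetD[OF AE])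
    also have "\<dots> = \<phi> ` (A <#> A)" by (auto simp: set_mult_def)
    finally have "\<phi> ` A <#>\<^bsub>H\<^esub> \<phi> ` A = \<phi> ` (A <#> A)" .
    moreover have "A <#> A \<subseteq> E" using AE Esub(1) by (auto simp: set_mult_def)
    ultimately show "card (\<phi> ` A <#>\<^bsub>H\<^esub> \<phi> ` A) = card (A <#> A)"
      using inj by (simp add: card_image inj_on_subset)
    obtain L where L: "L \<subseteq> A" "dissociated G L" "card L = additive_dim G A"
      using additive_dim_attained[OF A(2)] .
    have "card (\<phi> ` L) = card L" using injA L by (intro card_image) (rule inj_on_subset)
    moreover have "card (\<phi> ` L) \<le> additive_dim H (\<phi> ` A)"
      using A L diss by (intro H.card_le_additive_dim) auto
    ultimately show "additive_dim G A \<le> additive_dim H (\<phi> ` A)" using L by simp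
  qed
qed

text \<open>\<open>dim_const\<close> is an arbitrary choice among the constants valid for groups on
  natural numbers and may be smaller than \<open>10 ^ 9\<close>. The explicit constant therefore
  only shows that such a choice exists, and the bound for \<open>G\<close> has to be obtained from a
  copy of a subgroup on natural numbers.\<close>

theorem theorem13:
  shows "0 < dim_const \<and>
    (\<forall>(G :: ('a, 'b) monoid_scheme) (A :: 'a set) (K :: real).
       comm_group G \<longrightarrow> A \<subseteq> carrier G \<longrightarrow> finite A \<longrightarrow> 2 \<le> card A \<longrightarrow> 1 \<le> K \<longrightarrow>
       real (card (A <#>\<^bsub>G\<^esub> A)) \<le> K * real (card A) \<longrightarrow>
         real (additive_dim G A) \<le> dim_const * (K * log 2 (real (card A))) \<and>
         real (additive_dim G A) \<le>
           dim_const * (log 2 (real (card A))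
             + K * (log 2 K) ^ 8 * log 2 (log 2 (real (card A)))))"
proof -
  have const: "0 < dim_const \<and> (\<forall>G :: nat monoid. comm_group G \<longrightarrow> dim_bounds dim_const G)"
    unfolding dim_const_def
    by (rule someI[of _ "10 ^ 9"]) (use dim_bounds_uniform in force)
  show ?thesis
  proof (intro conjI[OF conjunct1[OF const]] allI impI)
    fix G :: "('a, 'b) monoid_scheme" and A :: "'a set" and K :: real
    assume "comm_group G" and A: "A \<subseteq> carrier G" "finite A" "2 \<le> card A" and K: "1 \<le> K"
      "real (card (A <#>\<^bsub>G\<^esub> A)) \<le> K * real (card A)"
    then obtain H :: "nat monoid" and B where H: "comm_group H" "B \<subseteq> carrier H" "finite B"
      "card B = card A" "card (B <#>\<^bsub>H\<^esub> B) = card (A <#>\<^bsub>G\<^esub> A)" "additive_dim G A \<le> additive_dim H B"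
      using transfer_to_nat[of G A] by blast
    have "dim_bounds dim_const H" using const H by blast
    then have "real (additive_dim H B) \<le> dim_const * (K * log 2 (real (card A))) \<and>
      real (additive_dim H B) \<le>
        dim_const * (log 2 (real (card A)) + K * (log 2 K) ^ 8 * log 2 (log 2 (real (card A))))"
      unfolding dim_bounds_def using H A K by metis
    then show "real (additive_dim G A) \<le> dim_const * (K * log 2 (real (card A))) \<and>
      real (additive_dim G A) \<le>
        dim_const * (log 2 (real (card A)) + K * (log 2 K) ^ 8 * log 2 (log 2 (real (card A))))"
      using H(6) by (meson of_nat_le_iff order_trans)
  qed
qed

end
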